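(* Let $R$ be an expansive real $d\times d$ matrix and let $B,L\subset\mathbb{R}^d$ be finite sets with $N:=\#B=\#L$, such that $R^n b\cdot l\in\mathbb{Z}$ for all $n\in\mathbb{N}=\{1,2,3,\dots\}$, $b\in B$, $l\in L$, and such that the $N\times N$ matrix $H_{B,L}:=N^{-1/2}\left(e^{i2\pi b\cdot l}\right)_{b\in B,\,l\in L}$ is unitary. Suppose $0\in L$ and $L$ spans $\mathbb{R}^d$. Let $\mu$, $\mathcal{L}$, $Q$, $C$, $Y$, $\|\cdot\|_{Y,\infty}$ and $H_2(\mathcal{L})$ be the objects associated with $(R,B,L)$ as defined in the context. If there exist $\gamma<1$ and a set $\mathcal{S}$ of $C^1$-functions containing $\mathbf{1}-Q$ such that $\|Cq\|_{Y,\infty}\le\gamma\|q\|_{Y,\infty}$ for all $q\in\mathcal{S}$, then $H_2(\mathcal{L})=L^2(\mu)$.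
   Context: A matrix is expansive if all its eigenvalues have absolute value greater than $1$. $R^*$ is the transpose of $R$. Write $e_\lambda(x):=e^{i2\pi\lambda\cdot x}$. $\mu$ is the unique probability measure on $\mathbb{R}^d$ satisfying $\mu=N^{-1}\sum_{b\in B}\mu\circ\sigma_b^{-1}$, where $\sigma_b(x):=R^{-1}x+b$. $\mathcal{L}:=\left\{\sum_{k=0}^{n}R^{*k}l_k: n\in\mathbb{N},\ l_k\in L\right\}$. $H_2(\mathcal{L})$ is the closed subspace of $L^2(\mu)$ spanned by $\{e_\lambda:\lambda\in\mathcal{L}\}$ (under the stated hypotheses this set is orthonormal in $L^2(\mu)$). $\chi_B(t):=N^{-1}\sum_{b\in B}e_b(t)$, and $\widehat{\mu}(t):=\int\overline{e_t(x)}\,d\mu(x)$. $Q(t):=\sum_{\lambda\in\mathcal{L}}|\widehat{\mu}(t-\lambda)|^2$ for $t\in\mathbb{R}^d$; $\mathbf{1}$ is the constant function $1$. $C$ is the Ruelle operator $(Cq)(t):=\sum_{l\in L}|\chi_B(t-l)|^2\,q(\rho_l(t))$, where $\rho_l(x):=R^{*-1}(x-l)$. $X_\rho:=\left\{\sum_{k=1}^{\infty}-R^{*-k}l_k: l_k\in L\right\}$ is the attractor of the system $\{\rho_l\}_{l\in L}$, and $Y$ is the convex hull of $X_\rho$. $\|q\|_{Y,\infty}:=\sup_{y\in Y}|\nabla q(y)|_2$, where $|\cdot|_2$ is the Euclidean norm. $C^1$-functions are understood to be defined on $\mathbb{R}^d$. *)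

theory Defs
  imports "HOL-Probability.Probability_Measure"
begin

subsection \<open>Matrices and exponentials\<close>

(* Eigenvalues are the complex ones, so R is regarded as a complex matrix. *)
definition expansive :: "real^'d^'d \<Rightarrow> bool" where
  "expansive R \<longleftrightarrow>
     (\<forall>(z::complex) (v::complex^'d).
        v \<noteq> 0 \<and> map_matrix complex_of_real R *v v = z *s v \<longrightarrow> 1 < cmod z)"

(* A^n v; the type of matrices carries no power operation for the matrix product. *)
definition mat_pow_vec :: "real^'d^'d \<Rightarrow> nat \<Rightarrow> real^'d \<Rightarrow> real^'d" where
  "mat_pow_vec A n v = ((\<lambda>w. A *v w) ^^ n) v"

definition e_fun :: "real^'d \<Rightarrow> real^'d \<Rightarrow> complex" where
  "e_fun l x = exp (\<i> * complex_of_real (2 * pi * (l \<bullet> x)))"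

definition H_matrix :: "(real^'d) set \<Rightarrow> real^'d \<Rightarrow> real^'d \<Rightarrow> complex" where
  "H_matrix B b l = e_fun b l / complex_of_real (sqrt (real (card B)))"

(* Unitarity H H^* = 1 = H^* H of a matrix with rows indexed by I and columns indexed by J. *)
definition unitary_on :: "'i set \<Rightarrow> 'j set \<Rightarrow> ('i \<Rightarrow> 'j \<Rightarrow> complex) \<Rightarrow> bool" where
  "unitary_on I J H \<longleftrightarrow>
     (\<forall>i\<in>I. \<forall>i'\<in>I. (\<Sum>j\<in>J. H i j * cnj (H i' j)) = (if i = i' then 1 else 0)) \<and>
     (\<forall>j\<in>J. \<forall>j'\<in>J. (\<Sum>i\<in>I. cnj (H i j) * H i j') = (if j = j' then 1 else 0))"

subsection \<open>The invariant measure and its Hilbert space\<close>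

definition sigma_map :: "real^'d^'d \<Rightarrow> real^'d \<Rightarrow> real^'d \<Rightarrow> real^'d" where
  "sigma_map R b x = matrix_inv R *v x + b"

(* For expansive R and finite nonempty B there is exactly one such measure (Hutchinson). *)
definition invariant_measure ::
    "real^'d^'d \<Rightarrow> (real^'d) set \<Rightarrow> (real^'d) measure \<Rightarrow> bool" where
  "invariant_measure R B M \<longleftrightarrow>
     prob_space M \<and> sets M = sets borel \<and>
     (\<forall>A\<in>sets borel.
        measure M A = (\<Sum>b\<in>B. measure (distr M borel (sigma_map R b)) A) / real (card B))"

(* L^2 is represented by square-integrable functions, not by classes modulo null sets;
   L2_closed_span is likewise closed under almost-everywhere equality. *)
definition L2_space :: "'a measure \<Rightarrow> ('a \<Rightarrow> complex) set" where
  "L2_space M = {f. f \<in> borel_measurable M \<and> integrable M (\<lambda>x. (cmod (f x))\<^sup>2)}"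

definition L2_norm :: "'a measure \<Rightarrow> ('a \<Rightarrow> complex) \<Rightarrow> real" where
  "L2_norm M f = sqrt (\<integral>x. (cmod (f x))\<^sup>2 \<partial>M)"

definition complex_lin_span :: "('a \<Rightarrow> complex) set \<Rightarrow> ('a \<Rightarrow> complex) set" where
  "complex_lin_span E = {(\<lambda>x. \<Sum>f\<in>F. c f * f x) | F c. finite F \<and> F \<subseteq> E}"

definition L2_closed_span :: "'a measure \<Rightarrow> ('a \<Rightarrow> complex) set \<Rightarrow> ('a \<Rightarrow> complex) set" where
  "L2_closed_span M E =
     {f \<in> L2_space M. \<forall>\<epsilon>>0. \<exists>g\<in>complex_lin_span E. L2_norm M (\<lambda>x. f x - g x) < \<epsilon>}"

definition frequencies :: "real^'d^'d \<Rightarrow> (real^'d) set \<Rightarrow> (real^'d) set" where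
  "frequencies R L =
     {(\<Sum>k=0..n. mat_pow_vec (transpose R) k (l k)) | (n::nat) l. 1 \<le> n \<and> (\<forall>k\<le>n. l k \<in> L)}"

definition H2 :: "(real^'d) measure \<Rightarrow> (real^'d) set \<Rightarrow> (real^'d \<Rightarrow> complex) set" where
  "H2 M \<Lambda> = L2_closed_span M (e_fun ` \<Lambda>)"

definition mu_hat :: "(real^'d) measure \<Rightarrow> real^'d \<Rightarrow> complex" where
  "mu_hat M t = (\<integral>x. cnj (e_fun t x) \<partial>M)"

definition Q_fun :: "real^'d^'d \<Rightarrow> (real^'d) set \<Rightarrow> (real^'d) measure \<Rightarrow> real^'d \<Rightarrow> real" where
  "Q_fun R L M t = (\<Sum>\<^sub>\<infinity>s\<in>frequencies R L. (cmod (mu_hat M (t - s)))\<^sup>2)"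

subsection \<open>The Ruelle operator\<close>

definition chi_fun :: "(real^'d) set \<Rightarrow> real^'d \<Rightarrow> complex" where
  "chi_fun B t = (\<Sum>b\<in>B. e_fun b t) / of_nat (card B)"

definition rho_map :: "real^'d^'d \<Rightarrow> real^'d \<Rightarrow> real^'d \<Rightarrow> real^'d" where
  "rho_map R l x = matrix_inv (transpose R) *v (x - l)"

definition ruelle_op ::
    "real^'d^'d \<Rightarrow> (real^'d) set \<Rightarrow> (real^'d) set \<Rightarrow> (real^'d \<Rightarrow> real) \<Rightarrow> real^'d \<Rightarrow> real" where
  "ruelle_op R B L q t = (\<Sum>l\<in>L. (cmod (chi_fun B (t - l)))\<^sup>2 * q (rho_map R l t))"

(* The library's sums counts from 0, so summand k here is term k+1 of the series. *)
definition X_rho :: "real^'d^'d \<Rightarrow> (real^'d) set \<Rightarrow> (real^'d) set" where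
  "X_rho R L =
     {x. \<exists>l. (\<forall>k\<ge>1. l k \<in> L) \<and>
        (\<lambda>k. - mat_pow_vec (matrix_inv (transpose R)) (Suc k) (l (Suc k))) sums x}"

definition Y_set :: "real^'d^'d \<Rightarrow> (real^'d) set \<Rightarrow> (real^'d) set" where
  "Y_set R L = convex hull (X_rho R L)"

definition C1_function :: "(real^'d \<Rightarrow> real) \<Rightarrow> bool" where
  "C1_function q \<longleftrightarrow> (\<exists>g. (\<forall>x. GDERIV q x :> g x) \<and> continuous_on UNIV g)"

definition grad :: "(real^'d \<Rightarrow> real) \<Rightarrow> real^'d \<Rightarrow> real^'d" where
  "grad q x = (THE D. GDERIV q x :> D)"

(* For expansive R and finite nonempty L the set Y is compact and nonempty, so for a
   C^1-function q this is the supremum of a nonempty bounded set of reals. *)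
definition norm_Y :: "(real^'d) set \<Rightarrow> (real^'d \<Rightarrow> real) \<Rightarrow> real" where
  "norm_Y Y q = (SUP y\<in>Y. norm (grad q y))"

end

theory Submission
  imports Defs "HOL-Computational_Algebra.Fundamental_Theorem_Algebra"
begin

text \<open>
  The exponentials \<open>e\<^sub>\<lambda>\<close> with \<open>\<lambda> \<in> \<L>\<close> are orthonormal in \<open>L\<^sup>2(\<mu>)\<close>, so \<open>Q t\<close> is the squared norm of the
  projection of the unit vector \<open>e\<^sub>t\<close> onto \<open>H\<^sub>2(\<L>)\<close>. Hence \<open>Q \<le> 1\<close>, and \<open>e\<^sub>t \<in> H\<^sub>2(\<L>)\<close> as soon as
  \<open>Q t = 1\<close> (\<open>e_fun_in_H2\<close>).

  The Fourier transform of the invariance of \<open>\<mu>\<close> is the refinement equation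
  \<open>mu_hat(t) = cnj (\<chi>\<^sub>B(t)) mu_hat(R\<^sup>*\<^sup>-\<^sup>1 t)\<close>, in which \<open>\<chi>\<^sub>B\<close> is periodic under \<open>R\<^sup>* \<L>\<close>. It yields the orthogonality
  of the exponentials and, since \<open>\<L> = L + R\<^sup>* \<L>\<close> with unique representations, the identity
  \<open>C Q = Q\<close> (\<open>ruelle_op_Q_fun\<close>). Unitarity of \<open>H\<close> gives \<open>C 1 = 1\<close>, so \<open>q = 1 - Q\<close> is a fixed
  point of \<open>C\<close>. The contraction hypothesis then forces \<open>\<nabla>q = 0\<close> on the convex bounded set \<open>Y\<close>, and
  because \<open>0 \<in> Y\<close> and \<open>Q 0 = 1\<close>, the function \<open>Q\<close> equals \<open>1\<close> on \<open>Y\<close> (\<open>constant_on_Y_of_contraction\<close>).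

  As \<open>L\<close> spans the space, \<open>Y\<close> has interior points (\<open>interior_Y_nonempty\<close>). So \<open>H\<^sub>2(\<L>)\<close> contains
  \<open>e\<^sub>t\<close> for all \<open>t\<close> in a nonempty open set. Since \<open>\<mu>\<close> has bounded support
  (\<open>invariant_measure_bounded_support\<close>), difference quotients in \<open>t\<close> converge in \<open>L\<^sup>2\<close> and show that
  \<open>e\<^sub>t p \<in> H\<^sub>2(\<L>)\<close> for all polynomials \<open>p\<close>; by the Weierstrass theorem the polynomials are dense in
  \<open>L\<^sup>2(\<mu>)\<close> (\<open>L2_subspace_exponentials_imp_all\<close>).

  Bounded support and boundedness of \<open>Y\<close> both rest on the decay of the powers of \<open>R\<^sup>-\<^sup>1\<close>. It is
  proved orbit by orbit: each vector is annihilated by a nonzero polynomial in the matrix, and the linear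
  factors of this polynomial are handled one at a time (\<open>summable_orbit_of_annihilator\<close>).
\<close>

section \<open>Decay of the powers of the inverse of an expansive matrix\<close>

text \<open>The vector \<open>p(A) v\<close>.\<close>

definition poly_act :: "complex^'d^'d \<Rightarrow> complex poly \<Rightarrow> complex^'d \<Rightarrow> complex^'d" where
  "poly_act A p v = (\<Sum>i\<le>degree p. coeff p i *s ((*v) A ^^ i) v)"

lemma poly_act_eq_sum:
  assumes "degree p \<le> n"
  shows "poly_act A p v = (\<Sum>i\<le>n. coeff p i *s ((*v) A ^^ i) v)"
  unfolding poly_act_def
  by (rule sum.mono_neutral_left) (use assms in \<open>auto simp: coeff_eq_0\<close>)

lemma matrix_orbit_add:
  fixes A :: "'a::field^'d^'d"
  shows "((*v) A ^^ k) (v + w) = ((*v) A ^^ k) v + ((*v) A ^^ k) w"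
  by (induction k) (auto simp: matrix_vector_right_distrib)

lemma matrix_orbit_scale:
  fixes A :: "'a::field^'d^'d"
  shows "((*v) A ^^ k) (c *s v) = c *s ((*v) A ^^ k) v"
  by (induction k) (auto simp: vector_scalar_commute)

lemma matrix_orbit_diff:
  fixes A :: "'a::field^'d^'d"
  shows "((*v) A ^^ k) (v - w) = ((*v) A ^^ k) v - ((*v) A ^^ k) w"
  by (induction k) (auto simp: matrix_vector_mult_diff_distrib)

lemma poly_act_linear_factor:
  fixes A :: "complex^'d^'d"
  shows "poly_act A ([:-z, 1:] * q) v = poly_act A q (A *v v - z *s v)"
    and "poly_act A ([:-z, 1:] * q) v = A *v poly_act A q v - z *s poly_act A q v"
proof -
  let ?n = "degree q"
  have deg: "degree ([:-z, 1:] * q) \<le> Suc ?n"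
    using degree_mult_le[of "[:-z, 1:]" q] by simp
  have c: "coeff ([:-z, 1:] * q) i = (case i of 0 \<Rightarrow> 0 | Suc j \<Rightarrow> coeff q j) - z * coeff q i" for i
    by (cases i) (auto simp: coeff_pCons)
  have "poly_act A ([:-z, 1:] * q) v
      = (\<Sum>i\<le>Suc ?n. (case i of 0 \<Rightarrow> 0 | Suc j \<Rightarrow> coeff q j) *s ((*v) A ^^ i) v)
        - (\<Sum>i\<le>Suc ?n. (z * coeff q i) *s ((*v) A ^^ i) v)"
    by (subst poly_act_eq_sum[OF deg], subst c)
       (simp only: vec.scale_left_diff_distrib sum_subtractf)
  also have "(\<Sum>i\<le>Suc ?n. (case i of 0 \<Rightarrow> 0 | Suc j \<Rightarrow> coeff q j) *s ((*v) A ^^ i) v)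
      = (\<Sum>i\<le>?n. coeff q i *s ((*v) A ^^ Suc i) v)"
    by (subst sum.atMost_Suc_shift) simp
  also have "(\<Sum>i\<le>Suc ?n. (z * coeff q i) *s ((*v) A ^^ i) v)
      = (\<Sum>i\<le>?n. coeff q i *s (z *s ((*v) A ^^ i) v))"
    by (simp add: coeff_eq_0 mult.commute)
  finally have *: "poly_act A ([:-z, 1:] * q) v =
      (\<Sum>i\<le>?n. coeff q i *s ((*v) A ^^ Suc i) v) - (\<Sum>i\<le>?n. coeff q i *s (z *s ((*v) A ^^ i) v))" .
  show "poly_act A ([:-z, 1:] * q) v = poly_act A q (A *v v - z *s v)"
    unfolding * unfolding poly_act_def
    by (simp only: matrix_orbit_diff matrix_orbit_scale vec.scale_right_diff_distrib sum_subtractf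
        funpow_Suc_right o_apply)
  have "(\<Sum>i\<le>?n. coeff q i *s ((*v) A ^^ Suc i) v) = A *v poly_act A q v"
    unfolding poly_act_def
    by (simp add: vec.linear_sum[OF matrix_vector_mul_linear_gen] vector_scalar_commute)
  moreover have "(\<Sum>i\<le>?n. coeff q i *s (z *s ((*v) A ^^ i) v)) = z *s poly_act A q v"
    unfolding poly_act_def by (simp add: vec.scale_sum_right mult.commute)
  ultimately show "poly_act A ([:-z, 1:] * q) v = A *v poly_act A q v - z *s poly_act A q v"
    unfolding * by simp
qed

text \<open>Summing the recurrence and absorbing the shifted sum into the left-hand side bounds all partial
  sums of \<open>s\<close> by \<open>(s\<^sub>0 + \<Sum>a) / (1 - c)\<close>.\<close>

lemma summable_of_contractive_recurrence:
  fixes s a :: "nat \<Rightarrow> real"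
  assumes nonneg: "\<And>k. 0 \<le> s k" and a: "summable a" "\<And>k. 0 \<le> a k"
    and c: "0 \<le> c" "c < 1" and rec: "\<And>k. s (Suc k) \<le> c * s k + a k"
  shows "summable s"
proof (rule bounded_imp_summable[OF nonneg])
  fix n
  have "(\<Sum>k<Suc m. s k) \<le> s 0 + c * (\<Sum>k<m. s k) + suminf a" for m
  proof -
    have "(\<Sum>k<Suc m. s k) = s 0 + (\<Sum>k<m. s (Suc k))"
      by (rule sum.lessThan_Suc_shift)
    also have "(\<Sum>k<m. s (Suc k)) \<le> (\<Sum>k<m. c * s k + a k)"
      by (intro sum_mono rec)
    also have "\<dots> = c * (\<Sum>k<m. s k) + (\<Sum>k<m. a k)"
      by (simp add: sum.distrib sum_distrib_left)
    also have "(\<Sum>k<m. a k) \<le> suminf a"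
      by (intro sum_le_suminf a) auto
    finally show ?thesis by simp
  qed
  from this[of n] have "(\<Sum>k\<le>n. s k) \<le> s 0 + c * (\<Sum>k<n. s k) + suminf a"
    by (simp add: lessThan_Suc_atMost)
  moreover have "(\<Sum>k<n. s k) \<le> (\<Sum>k\<le>n. s k)"
    by (rule sum_mono2) (auto simp: nonneg)
  ultimately have "(\<Sum>k\<le>n. s k) \<le> s 0 + c * (\<Sum>k\<le>n. s k) + suminf a"
    using c by (meson add_mono mult_left_mono order_refl order_trans)
  hence "(1 - c) * (\<Sum>k\<le>n. s k) \<le> s 0 + suminf a"
    by (simp add: algebra_simps)
  then show "(\<Sum>k\<le>n. s k) \<le> (s 0 + suminf a) / (1 - c)"
    using c by (simp add: field_simps)
qed

text \<open>If \<open>p(A) v = 0\<close>, split off a root \<open>z\<close> of \<open>p = (X - z) q\<close>. Either \<open>\<bar>z\<bar> < 1\<close>, and then the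
  orbit of \<open>v\<close> is driven by the orbit of \<open>A v - z v\<close>, which \<open>q\<close> annihilates, through a
  contractive recurrence; or \<open>z\<close> is not an eigenvalue, and then already \<open>q(A) v = 0\<close>.\<close>

lemma summable_orbit_of_annihilator:
  fixes A :: "complex^'d^'d"
  assumes ev: "\<And>z w. w \<noteq> 0 \<Longrightarrow> A *v w = z *s w \<Longrightarrow> cmod z < 1"
    and "p \<noteq> 0" "poly_act A p v = 0"
  shows "summable (\<lambda>k. norm (((*v) A ^^ k) v))"
  using assms(2,3)
proof (induction "degree p" arbitrary: p v)
  case 0
  then obtain c where "p = [:c:]" "c \<noteq> 0"
    by (metis degree_eq_zeroE pCons_eq_0_iff)
  with 0 have v0: "v = 0"
    by (simp add: poly_act_def)
  have "((*v) A ^^ k) v = 0" for k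
    unfolding v0 by (induction k) auto
  then show ?case by simp
next
  case (Suc n)
  obtain z where "poly p z = 0"
    using Suc.hyps(2) fundamental_theorem_of_algebra[of p]
    by (metis Zero_not_Suc constant_degree)
  then obtain q where p: "p = [:-z, 1:] * q"
    by (metis dvdE poly_eq_0_iff_dvd)
  with Suc.prems have q: "q \<noteq> 0" by auto
  with Suc.hyps(2) p have deg: "n = degree q"
    by (simp add: degree_mult_eq del: mult_pCons_left)
  show ?case
  proof (cases "cmod z < 1")
    case True
    let ?v' = "A *v v - z *s v"
    have "poly_act A q ?v' = 0"
      using Suc.prems p poly_act_linear_factor(1) by metis
    then have sum': "summable (\<lambda>k. norm (((*v) A ^^ k) ?v'))"
      by (intro Suc.hyps(1)[OF deg q])
    have norm_scale: "norm (z *s x) = cmod z * norm x" for x :: "complex^'d"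
      by (simp add: norm_vec_def norm_mult L2_set_right_distrib)
    have step: "((*v) A ^^ Suc k) v = z *s ((*v) A ^^ k) v + ((*v) A ^^ k) ?v'" for k
      by (simp add: matrix_orbit_diff matrix_orbit_scale funpow_swap1)
    show ?thesis
    proof (rule summable_of_contractive_recurrence[OF _ sum' _ _ True])
      show "norm (((*v) A ^^ Suc k) v)
          \<le> cmod z * norm (((*v) A ^^ k) v) + norm (((*v) A ^^ k) ?v')" for k
        unfolding step using norm_triangle_ineq norm_scale by metis
    qed auto
  next
    case False
    have "A *v poly_act A q v = z *s poly_act A q v"
      using Suc.prems p poly_act_linear_factor(2)[of A z q v] by simp
    then have "poly_act A q v = 0"
      using ev False by blast
    then show ?thesis by (intro Suc.hyps(1)[OF deg q])
  qed
qed

lemma exists_linear_relation: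
  fixes u :: "nat \<Rightarrow> 'a::euclidean_space"
  obtains c :: "nat \<Rightarrow> real" and n where "(\<Sum>i\<le>n. c i *\<^sub>R u i) = 0" "\<exists>i\<le>n. c i \<noteq> 0"
proof (cases "inj_on u {..DIM('a)}")
  case True
  then have "card (u ` {..DIM('a)}) = Suc DIM('a)"
    by (simp add: card_image)
  then have "dependent (u ` {..DIM('a)})"
    by (intro dependent_biggerset) auto
  then obtain d v where d: "v \<in> u ` {..DIM('a)}" "d v \<noteq> 0"
      "(\<Sum>v\<in>u ` {..DIM('a)}. d v *\<^sub>R v) = 0"
    using dependent_finite[of "u ` {..DIM('a)}"] by auto
  show ?thesis
    using d True by (intro that[where n = "DIM('a)" and c = "d \<circ> u"]) (auto simp: sum.reindex)
next
  case False
  then obtain i j where ij: "i \<le> DIM('a)" "j \<le> DIM('a)" "i \<noteq> j" "u i = u j"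
    by (auto simp: inj_on_def)
  define c :: "nat \<Rightarrow> real" where "c k = (if k = i then 1 else 0) - (if k = j then 1 else 0)" for k
  have "(\<Sum>k\<le>DIM('a). c k *\<^sub>R u k)
      = (\<Sum>k\<le>DIM('a). if k = i then u k else 0) - (\<Sum>k\<le>DIM('a). if k = j then u k else 0)"
    unfolding c_def sum_subtractf[symmetric] by (rule sum.cong) auto
  also have "\<dots> = 0"
    using ij by simp
  finally show ?thesis
    using ij by (intro that[where n = "DIM('a)" and c = c]) (auto simp: c_def intro!: exI[of _ i])
qed

text \<open>In a finite-dimensional space the vectors \<open>v, A v, A\<^sup>2 v, \<dots>\<close> are linearly dependent; a relation
  between them is a nonzero polynomial that annihilates \<open>v\<close>.\<close>

lemma summable_orbit:
  fixes A :: "complex^'d^'d"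
  assumes ev: "\<And>z w. w \<noteq> 0 \<Longrightarrow> A *v w = z *s w \<Longrightarrow> cmod z < 1"
  shows "summable (\<lambda>k. norm (((*v) A ^^ k) v))"
proof -
  obtain c n where c: "(\<Sum>i\<le>n. c i *\<^sub>R ((*v) A ^^ i) v) = 0" "\<exists>i\<le>n. c i \<noteq> 0"
    by (rule exists_linear_relation)
  define p where "p = (\<Sum>i\<le>n. monom (complex_of_real (c i)) i)"
  have coeff: "coeff p i = (if i \<le> n then complex_of_real (c i) else 0)" for i
    unfolding p_def by (simp add: coeff_sum)
  have "degree p \<le> n"
    by (rule degree_le) (auto simp: coeff)
  then have "poly_act A p v = (\<Sum>i\<le>n. coeff p i *s ((*v) A ^^ i) v)"
    by (rule poly_act_eq_sum)
  also have "\<dots> = (\<Sum>i\<le>n. c i *\<^sub>R ((*v) A ^^ i) v)"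
    by (intro sum.cong) (auto simp: coeff vec_eq_iff scaleR_conv_of_real[where 'a = complex])
  finally have "poly_act A p v = 0" using c by simp
  moreover have "p \<noteq> 0"
    using c(2) coeff by (metis coeff_0 of_real_eq_0_iff)
  ultimately show ?thesis
    by (intro summable_orbit_of_annihilator[OF ev, where p = p])
qed

definition complexify :: "real^'d \<Rightarrow> complex^'d" where
  "complexify v = (\<chi> i. complex_of_real (v $ i))"

lemma norm_complexify: "norm (complexify v) = norm v"
  by (simp add: norm_vec_def complexify_def)

lemma complexify_eq_0_iff [simp]: "complexify v = 0 \<longleftrightarrow> v = 0"
  by (simp add: vec_eq_iff complexify_def)

lemma complexify_mult: "map_matrix complex_of_real A *v complexify v = complexify (A *v v)"
  by (simp add: vec_eq_iff complexify_def matrix_vector_mult_def map_matrix_def)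

lemma map_matrix_of_real_mult:
  "map_matrix complex_of_real A ** map_matrix complex_of_real B = map_matrix complex_of_real (A ** B)"
  by (simp add: vec_eq_iff matrix_matrix_mult_def map_matrix_def)

lemma expansiveD:
  assumes "expansive R" "v \<noteq> 0" "map_matrix complex_of_real R *v v = z *s v"
  shows "1 < cmod z"
  using assms(1)[unfolded expansive_def, THEN spec, THEN spec, THEN mp, OF conjI, OF assms(2,3)] .

lemma expansive_invertible:
  fixes R :: "real^'d^'d"
  assumes "expansive R"
  shows "invertible R"
proof -
  have "v = 0" if "R *v v = 0" for v
  proof (rule ccontr)
    assume "v \<noteq> 0"
    moreover have "map_matrix complex_of_real R *v complexify v = 0 *s complexify v"
      using that by (simp add: complexify_mult)
    ultimately have "1 < cmod 0"
      by (intro expansiveD[OF assms, of "complexify v"]) simp_all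
    then show False by simp
  qed
  then show ?thesis
    by (simp add: invertible_left_inverse matrix_left_invertible_ker)
qed

lemma matrix_inv_mult:
  fixes A :: "'a::semiring_1^'n^'m"
  assumes "invertible A"
  shows "A ** matrix_inv A = mat 1" "matrix_inv A ** A = mat 1"
  using someI_ex[OF assms[unfolded invertible_def]] by (auto simp: matrix_inv_def)

lemma summable_inverse_orbit:
  fixes R :: "real^'d^'d"
  assumes "expansive R"
  shows "summable (\<lambda>k. norm (mat_pow_vec (matrix_inv R) k v))"
proof -
  let ?A = "map_matrix complex_of_real (matrix_inv R)"
  have inv: "R ** matrix_inv R = mat 1"
    using expansive_invertible[OF assms] by (rule matrix_inv_mult)
  have id: "map_matrix complex_of_real (mat 1 :: real^'d^'d) = mat 1"
    by (simp add: vec_eq_iff mat_def map_matrix_def)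
  have "cmod z < 1" if w: "w \<noteq> 0" "?A *v w = z *s w" for z w
  proof -
    have "w = (map_matrix complex_of_real R ** ?A) *v w"
      by (simp add: map_matrix_of_real_mult inv id)
    also have "\<dots> = z *s (map_matrix complex_of_real R *v w)"
      by (simp add: matrix_vector_mul_assoc[symmetric] w vector_scalar_commute)
    finally have *: "w = z *s (map_matrix complex_of_real R *v w)" .
    with w(1) have z: "z \<noteq> 0" by auto
    have "map_matrix complex_of_real R *v w = inverse z *s w"
      by (subst (2) *) (use z in simp)
    with w(1) have "1 < cmod (inverse z)"
      by (intro expansiveD[OF assms])
    with z show ?thesis
      by (simp add: norm_inverse one_less_inverse_iff)
  qed
  then have "summable (\<lambda>k. norm (((*v) ?A ^^ k) (complexify v)))"
    by (rule summable_orbit)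
  moreover have "((*v) ?A ^^ k) (complexify v) = complexify (mat_pow_vec (matrix_inv R) k v)" for k
    by (induction k) (auto simp: mat_pow_vec_def complexify_mult)
  ultimately show ?thesis
    by (simp add: norm_complexify)
qed

lemma mat_pow_vec_simps [simp]:
  "mat_pow_vec A 0 v = v" "mat_pow_vec A (Suc k) v = A *v mat_pow_vec A k v"
  by (simp_all add: mat_pow_vec_def)

lemma mat_pow_vec_Suc_right: "mat_pow_vec A (Suc k) v = mat_pow_vec A k (A *v v)"
  by (simp add: mat_pow_vec_def funpow_swap1)

lemma mat_pow_vec_add: "mat_pow_vec A k (v + w) = mat_pow_vec A k v + mat_pow_vec A k w"
  by (simp add: mat_pow_vec_def matrix_orbit_add)

lemma mat_pow_vec_zero [simp]: "mat_pow_vec A k 0 = 0"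
  by (induction k) auto

lemma mat_pow_vec_scaleR: "mat_pow_vec A k (c *\<^sub>R v) = c *\<^sub>R mat_pow_vec A k v"
  by (induction k) (auto simp: matrix_vector_mult_scaleR)

lemma inner_transpose: "(transpose A *v x) \<bullet> y = x \<bullet> (A *v y)"
  for A :: "real^'n^'m"
  by (metis dot_lmul_matrix transpose_matrix_vector)

lemma inner_mat_pow_vec_transpose: "mat_pow_vec (transpose A) k x \<bullet> y = x \<bullet> mat_pow_vec A k y"
  for A :: "real^'d^'d"
  by (induction k arbitrary: y) (simp_all add: inner_transpose mat_pow_vec_Suc_right[symmetric] del: transpose_matrix_vector)

lemma matrix_inv_transpose:
  fixes A :: "real^'d^'d"
  assumes "invertible A"
  shows "matrix_inv (transpose A) = transpose (matrix_inv A)"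
proof -
  have inv: "invertible (transpose A)"
    using assms by (rule transpose_invertible)
  have right: "transpose A ** transpose (matrix_inv A) = mat 1"
    by (simp add: matrix_transpose_mul[symmetric] matrix_inv_mult assms transpose_mat)
  have "transpose (matrix_inv A) = (matrix_inv (transpose A) ** transpose A) ** transpose (matrix_inv A)"
    by (simp add: matrix_inv_mult[OF inv])
  also have "\<dots> = matrix_inv (transpose A)"
    by (simp only: matrix_mul_assoc[symmetric] right matrix_mul_rid)
  finally show ?thesis ..
qed

text \<open>The Lyapunov norm \<open>\<Sum>k. |R\<^sup>-\<^sup>k v|\<close>, for which \<open>R\<^sup>-\<^sup>1\<close> is a strict contraction if \<open>R\<close> is
  expansive.\<close>

definition adapted_norm :: "real^'d^'d \<Rightarrow> real^'d \<Rightarrow> real" where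
  "adapted_norm R v = (\<Sum>k. norm (mat_pow_vec (matrix_inv R) k v))"

context
  fixes R :: "real^'d^'d"
  assumes expansive: "expansive R"
begin

lemma adapted_norm_nonneg: "0 \<le> adapted_norm R v"
  unfolding adapted_norm_def by (intro suminf_nonneg summable_inverse_orbit expansive) auto

lemma norm_le_adapted_norm: "norm v \<le> adapted_norm R v"
  unfolding adapted_norm_def
  using sum_le_suminf[OF summable_inverse_orbit[OF expansive], of "{0}" v] by simp

lemma adapted_norm_inverse: "adapted_norm R (matrix_inv R *v v) = adapted_norm R v - norm v"
  unfolding adapted_norm_def mat_pow_vec_Suc_right[symmetric]
  by (subst suminf_split_head[OF summable_inverse_orbit[OF expansive]]) simp

lemma adapted_norm_add: "adapted_norm R (v + w) \<le> adapted_norm R v + adapted_norm R w"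
proof -
  note summable = summable_inverse_orbit[OF expansive]
  have "adapted_norm R (v + w) \<le>
      (\<Sum>k. norm (mat_pow_vec (matrix_inv R) k v) + norm (mat_pow_vec (matrix_inv R) k w))"
    unfolding adapted_norm_def
    by (rule suminf_le[OF _ summable summable_add[OF summable summable]])
       (simp add: mat_pow_vec_add norm_triangle_ineq)
  also have "\<dots> = adapted_norm R v + adapted_norm R w"
    unfolding adapted_norm_def by (rule suminf_add[OF summable summable, symmetric])
  finally show ?thesis .
qed

lemma adapted_norm_sum: "finite I \<Longrightarrow> adapted_norm R (\<Sum>i\<in>I. f i) \<le> (\<Sum>i\<in>I. adapted_norm R (f i))"
proof (induction I rule: finite_induct)
  case empty
  then show ?case by (simp add: adapted_norm_def)
next
  case (insert i I)
  then show ?case using adapted_norm_add[of "f i" "sum f I"] by simp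
qed

lemma adapted_norm_scaleR: "adapted_norm R (c *\<^sub>R v) = \<bar>c\<bar> * adapted_norm R v"
  unfolding adapted_norm_def mat_pow_vec_scaleR
  by (simp add: suminf_mult[OF summable_inverse_orbit[OF expansive]])

lemma adapted_norm_le:
  "adapted_norm R v \<le> (1 + (\<Sum>j\<in>Basis. adapted_norm R j)) * norm v"
proof -
  have "adapted_norm R v = adapted_norm R (\<Sum>j\<in>Basis. (v \<bullet> j) *\<^sub>R j)"
    by (simp add: euclidean_representation)
  also have "\<dots> \<le> (\<Sum>j\<in>Basis. \<bar>v \<bullet> j\<bar> * adapted_norm R j)"
    using adapted_norm_sum[of Basis "\<lambda>j. (v \<bullet> j) *\<^sub>R j"] by (simp add: adapted_norm_scaleR)
  also have "\<dots> \<le> (\<Sum>j\<in>Basis. norm v * adapted_norm R j)"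
    by (intro sum_mono mult_right_mono Basis_le_norm adapted_norm_nonneg)
  also have "\<dots> \<le> (1 + (\<Sum>j\<in>Basis. adapted_norm R j)) * norm v"
    by (simp add: sum_distrib_left[symmetric] algebra_simps)
  finally show ?thesis .
qed

text \<open>The identity \<open>\<parallel>R\<^sup>-\<^sup>1 v\<parallel> = \<parallel>v\<parallel> - |v|\<close> for the adapted norm, together with \<open>\<parallel>v\<parallel> \<le> C |v|\<close>, gives
  the contraction factor \<open>1 - 1 / C\<close>.\<close>

lemma adapted_norm_contraction:
  obtains \<theta> where "0 \<le> \<theta>" "\<theta> < 1"
    "\<And>v. adapted_norm R (matrix_inv R *v v) \<le> \<theta> * adapted_norm R v"
proof -
  define C where "C = 1 + (\<Sum>j\<in>Basis. adapted_norm R j)"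
  have C: "1 \<le> C"
    unfolding C_def by (simp add: sum_nonneg adapted_norm_nonneg)
  have "adapted_norm R (matrix_inv R *v v) \<le> (1 - 1 / C) * adapted_norm R v" for v
    unfolding adapted_norm_inverse
    using adapted_norm_le[of v] C by (simp add: C_def[symmetric] field_simps)
  with C show ?thesis
    by (intro that[of "1 - 1 / C"]) (auto simp: field_simps)
qed

text \<open>The powers of \<open>R\<^sup>*\<^sup>-\<^sup>1\<close> inherit the decay of the powers of \<open>R\<^sup>-\<^sup>1\<close>, because the coordinates of
  \<open>R\<^sup>*\<^sup>-\<^sup>k v\<close> are the inner products of \<open>v\<close> with the vectors \<open>R\<^sup>-\<^sup>k j\<close>, where \<open>j\<close> is in the basis.\<close>

lemma summable_inverse_transpose_orbit:
  obtains a where "summable a"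
    "\<And>k v. norm (mat_pow_vec (matrix_inv (transpose R)) k v) \<le> a k * norm v"
proof
  let ?a = "\<lambda>k. \<Sum>j\<in>Basis. norm (mat_pow_vec (matrix_inv R) k j)"
  show "summable ?a"
    by (intro summable_sum summable_inverse_orbit expansive)
  fix k v
  let ?w = "mat_pow_vec (matrix_inv (transpose R)) k v"
  have "norm ?w \<le> (\<Sum>j\<in>Basis. \<bar>?w \<bullet> j\<bar>)"
    by (rule norm_le_l1)
  also have "\<dots> = (\<Sum>j\<in>Basis. \<bar>v \<bullet> mat_pow_vec (matrix_inv R) k j\<bar>)"
    by (simp add: matrix_inv_transpose expansive_invertible expansive inner_mat_pow_vec_transpose)
  also have "\<dots> \<le> (\<Sum>j\<in>Basis. norm v * norm (mat_pow_vec (matrix_inv R) k j))"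
    by (intro sum_mono Cauchy_Schwarz_ineq2)
  also have "\<dots> = ?a k * norm v"
    by (simp add: sum_distrib_left mult.commute)
  finally show "norm ?w \<le> ?a k * norm v" .
qed

end

section \<open>The invariant measure\<close>

lemma borel_measurable_sigma_map [measurable]: "sigma_map R b \<in> borel_measurable borel"
  unfolding sigma_map_def
  by (intro borel_measurable_continuous_onI continuous_intros
      linear_continuous_on matrix_vector_mul_bounded_linear)

lemma borel_measurable_adapted_norm: "expansive R \<Longrightarrow> adapted_norm R \<in> borel_measurable borel"
proof -
  have "(\<lambda>v. norm (mat_pow_vec A k v)) \<in> borel_measurable borel" for A :: "real^'d^'d" and k
  proof -
    have "continuous_on UNIV (mat_pow_vec A k)"
    proof (induction k)
      case (Suc k)
      have "continuous_on UNIV ((*v) A \<circ> mat_pow_vec A k)"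
        by (intro continuous_on_compose Suc linear_continuous_on matrix_vector_mul_bounded_linear)
      then show ?case by (simp add: o_def)
    qed simp
    then show ?thesis
      by (intro borel_measurable_continuous_onI continuous_intros)
  qed
  then show ?thesis
    unfolding adapted_norm_def by (intro borel_measurable_suminf)
qed

context
  fixes R :: "real^'d^'d" and B :: "(real^'d) set" and \<mu> :: "(real^'d) measure"
  assumes finite_B: "finite B" and B_ne: "B \<noteq> {}" and inv: "invariant_measure R B \<mu>"
begin

interpretation prob_space \<mu>
  using inv by (simp add: invariant_measure_def)

lemma sets_invariant_measure: "sets \<mu> = sets borel"
  using inv by (simp add: invariant_measure_def)

lemma space_invariant_measure: "space \<mu> = UNIV"
  using sets_eq_imp_space_eq[OF sets_invariant_measure] by simp

lemma sigma_map_measurable: "sigma_map R b \<in> borel_measurable \<mu>"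
  by (simp add: measurable_cong_sets[OF sets_invariant_measure refl])

lemma measure_invariant_measure:
  assumes "A \<in> sets borel"
  shows "measure \<mu> A = (\<Sum>b\<in>B. measure \<mu> (sigma_map R b -` A)) / real (card B)"
proof -
  have "measure (distr \<mu> borel (sigma_map R b)) A = measure \<mu> (sigma_map R b -` A)" for b
    by (subst measure_distr[OF sigma_map_measurable assms]) (simp add: space_invariant_measure)
  then show ?thesis
    using inv assms by (simp add: invariant_measure_def)
qed

text \<open>In the adapted norm all \<open>\<sigma>\<^sub>b\<close> contract towards the ball of radius \<open>r\<^sub>0 = \<beta> / (1 - \<theta>)\<close>, so by
  invariance the ball of radius \<open>r\<^sub>0 + \<theta>\<^sup>m s\<close> carries at least the mass of the ball of radius
  \<open>r\<^sub>0 + s\<close>. Hence one fixed ball has at least the mass of every larger ball, which is full mass.\<close>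

lemma invariant_measure_bounded_support:
  assumes exp: "expansive R"
  obtains r where "AE x in \<mu>. norm x \<le> r"
proof -
  let ?\<phi> = "adapted_norm R"
  obtain \<theta> where \<theta>: "0 \<le> \<theta>" "\<theta> < 1" "\<And>v. ?\<phi> (matrix_inv R *v v) \<le> \<theta> * ?\<phi> v"
    using adapted_norm_contraction[OF exp] by blast
  define \<beta> where "\<beta> = (\<Sum>b\<in>B. ?\<phi> b)"
  define r\<^sub>0 where "r\<^sub>0 = \<beta> / (1 - \<theta>)"
  have \<beta>: "?\<phi> b \<le> \<beta>" if "b \<in> B" for b
    unfolding \<beta>_def using that finite_B
    by (intro member_le_sum adapted_norm_nonneg exp)
  have r\<^sub>0: "\<theta> * r\<^sub>0 + \<beta> = r\<^sub>0"
    using \<theta> by (simp add: r\<^sub>0_def field_simps)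
  have sets [measurable]: "{x. ?\<phi> x \<le> r} \<in> sets borel" for r
    using borel_measurable_adapted_norm[OF exp] by measurable
  have step: "measure \<mu> {x. ?\<phi> x \<le> r} \<le> measure \<mu> {x. ?\<phi> x \<le> \<theta> * r + \<beta>}" for r
  proof -
    have sub: "{x. ?\<phi> x \<le> r} \<subseteq> sigma_map R b -` {x. ?\<phi> x \<le> \<theta> * r + \<beta>}" if b: "b \<in> B" for b
    proof
      fix x assume "x \<in> {x. ?\<phi> x \<le> r}"
      then have "\<theta> * ?\<phi> x \<le> \<theta> * r"
        using \<theta> by (simp add: mult_left_mono)
      moreover have "?\<phi> (sigma_map R b x) \<le> ?\<phi> (matrix_inv R *v x) + ?\<phi> b"
        unfolding sigma_map_def by (rule adapted_norm_add[OF exp])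
      ultimately show "x \<in> sigma_map R b -` {x. ?\<phi> x \<le> \<theta> * r + \<beta>}"
        using \<theta>(3)[of x] \<beta>[OF b] by simp
    qed
    have "measure \<mu> {x. ?\<phi> x \<le> r} = (\<Sum>b\<in>B. measure \<mu> {x. ?\<phi> x \<le> r}) / card B"
      using finite_B B_ne by simp
    also have "\<dots> \<le> (\<Sum>b\<in>B. measure \<mu> (sigma_map R b -` {x. ?\<phi> x \<le> \<theta> * r + \<beta>})) / card B"
      using measurable_sets[OF borel_measurable_sigma_map sets]
      by (intro divide_right_mono sum_mono finite_measure_mono sub)
         (auto simp: sets_invariant_measure)
    also have "\<dots> = measure \<mu> {x. ?\<phi> x \<le> \<theta> * r + \<beta>}"
      by (rule measure_invariant_measure[symmetric]) simp
    finally show ?thesis .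
  qed
  have iter: "measure \<mu> {x. ?\<phi> x \<le> r\<^sub>0 + s} \<le> measure \<mu> {x. ?\<phi> x \<le> r\<^sub>0 + \<theta> ^ m * s}" for s m
  proof (induction m)
    case (Suc m)
    have "\<theta> * (r\<^sub>0 + \<theta> ^ m * s) + \<beta> = r\<^sub>0 + \<theta> ^ Suc m * s"
      using r\<^sub>0 by (simp add: algebra_simps)
    then show ?case
      using Suc step[of "r\<^sub>0 + \<theta> ^ m * s"] by simp
  qed simp
  have le: "measure \<mu> {x. ?\<phi> x \<le> r\<^sub>0 + real n} \<le> measure \<mu> {x. ?\<phi> x \<le> r\<^sub>0 + 1}" for n
  proof -
    obtain m where "\<theta> ^ m < 1 / (real n + 1)"
      using real_arch_pow_inv[of "1 / (real n + 1)" \<theta>] \<theta> by auto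
    then have "\<theta> ^ m * real n + \<theta> ^ m < 1"
      by (simp add: field_simps)
    with zero_le_power[OF \<theta>(1), of m] have "\<theta> ^ m * real n \<le> 1"
      by linarith
    then have "measure \<mu> {x. ?\<phi> x \<le> r\<^sub>0 + \<theta> ^ m * real n} \<le> measure \<mu> {x. ?\<phi> x \<le> r\<^sub>0 + 1}"
      by (intro finite_measure_mono) (auto simp: sets_invariant_measure)
    with iter show ?thesis by (rule order_trans)
  qed
  have "(\<Union>n. {x. ?\<phi> x \<le> r\<^sub>0 + real n}) = space \<mu>"
  proof -
    have "\<exists>n. ?\<phi> x \<le> r\<^sub>0 + real n" for x
      using real_arch_simple[of "?\<phi> x - r\<^sub>0"] by (auto simp: algebra_simps)
    then show ?thesis by (auto simp: space_invariant_measure)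
  qed
  moreover have "(\<lambda>n. measure \<mu> {x. ?\<phi> x \<le> r\<^sub>0 + real n}) \<longlonglongrightarrow>
      measure \<mu> (\<Union>n. {x. ?\<phi> x \<le> r\<^sub>0 + real n})"
    by (rule finite_Lim_measure_incseq)
       (auto simp: sets_invariant_measure incseq_def)
  ultimately have "(\<lambda>n. measure \<mu> {x. ?\<phi> x \<le> r\<^sub>0 + real n}) \<longlonglongrightarrow> 1"
    by (simp add: prob_space)
  then have "1 \<le> measure \<mu> {x. ?\<phi> x \<le> r\<^sub>0 + 1}"
    by (rule LIMSEQ_le_const2) (use le in auto)
  then have "measure \<mu> {x. ?\<phi> x \<le> r\<^sub>0 + 1} = 1"
    by (simp add: measure_ge_1_iff)
  then have "AE x in \<mu>. x \<in> {x. ?\<phi> x \<le> r\<^sub>0 + 1}"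
    by (subst (asm) prob_eq_1) (auto simp: sets_invariant_measure)
  then have "AE x in \<mu>. norm x \<le> r\<^sub>0 + 1"
    using norm_le_adapted_norm[OF exp] by (auto intro: order_trans)
  then show ?thesis by (rule that)
qed

text \<open>Invariance says that \<open>\<mu>\<close> is the image of the product of the uniform distribution on \<open>B\<close> with \<open>\<mu>\<close>
  under \<open>(b, x) \<mapsto> \<sigma>\<^sub>b x\<close>; the formula is Fubini's theorem for this product.\<close>

lemma integral_invariant_measure:
  fixes f :: "real^'d \<Rightarrow> complex"
  assumes f: "f \<in> borel_measurable borel" and bounded: "\<And>x. cmod (f x) \<le> K"
  shows "(\<integral>x. f x \<partial>\<mu>) = (\<Sum>b\<in>B. \<integral>x. f (sigma_map R b x) \<partial>\<mu>) / of_nat (card B)"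
proof -
  let ?U = "uniform_count_measure B"
  let ?P = "?U \<Otimes>\<^sub>M \<mu>"
  let ?g = "\<lambda>p. sigma_map R (fst p) (snd p)"
  have U: "prob_space ?U"
    using finite_B B_ne by (rule prob_space_uniform_count_measure)
  interpret U: prob_space ?U by fact
  interpret P: pair_prob_space ?U \<mu> ..
  have "(\<lambda>b. b) \<in> measurable ?U borel"
    by (simp add: measurable_def space_uniform_count_measure sets_uniform_count_measure)
  then have fst_meas: "fst \<in> borel_measurable ?P"
    using measurable_compose[OF measurable_fst] by fast
  have "(\<lambda>x. matrix_inv R *v x) \<in> borel_measurable borel"
    using borel_measurable_sigma_map[of R 0] by (simp add: sigma_map_def[abs_def])
  then have "(\<lambda>p. matrix_inv R *v snd p) \<in> borel_measurable ?P"
    by (intro measurable_compose[OF measurable_snd])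
       (simp add: measurable_cong_sets[OF sets_invariant_measure refl])
  then have g: "?g \<in> borel_measurable ?P"
    unfolding sigma_map_def using fst_meas by (rule borel_measurable_add)
  have eq: "\<mu> = distr ?P borel ?g"
  proof (rule measure_eqI)
    fix A assume "A \<in> sets \<mu>"
    then have A: "A \<in> sets borel" by (simp add: sets_invariant_measure)
    have "emeasure (distr ?P borel ?g) A = emeasure ?P (?g -` A \<inter> space ?P)"
      using g A by (rule emeasure_distr)
    also have "\<dots> = (\<integral>\<^sup>+b. emeasure \<mu> (Pair b -` (?g -` A \<inter> space ?P)) \<partial>?U)"
      using measurable_sets[OF g A] by (rule emeasure_pair_measure_alt)
    also have "\<dots> = (\<integral>\<^sup>+b. emeasure \<mu> (sigma_map R b -` A) \<partial>?U)"
      by (intro nn_integral_cong arg_cong[where f = "emeasure \<mu>"])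
         (auto simp: space_pair_measure space_invariant_measure)
    also have "\<dots> = (\<Sum>b\<in>B. emeasure \<mu> (sigma_map R b -` A) * ennreal (1 / card B))"
      unfolding uniform_count_measure_def
      by (subst nn_integral_point_measure_finite) (use finite_B in \<open>auto simp: mult.commute\<close>)
    also have "\<dots> = ennreal (\<Sum>b\<in>B. measure \<mu> (sigma_map R b -` A) * (1 / card B))"
      by (subst sum_ennreal[symmetric]) (auto simp: emeasure_eq_measure ennreal_mult[symmetric])
    also have "\<dots> = emeasure \<mu> A"
      by (simp add: emeasure_eq_measure measure_invariant_measure[OF A] sum_divide_distrib)
    finally show "emeasure \<mu> A = emeasure (distr ?P borel ?g) A" ..
  qed (simp add: sets_invariant_measure)
  have int: "integrable ?P (\<lambda>p. f (?g p))"
    using measurable_compose[OF g f]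
    by (intro P.P.integrable_const_bound[where B = K]) (auto simp: bounded)
  have "(\<integral>x. f x \<partial>\<mu>) = (\<integral>p. f (?g p) \<partial>?P)"
    by (subst eq) (rule integral_distr[OF g f])
  also have "\<dots> = (\<integral>b. (\<integral>x. f (sigma_map R b x) \<partial>\<mu>) \<partial>?U)"
    using P.integral_fst'[OF int] by simp
  also have "\<dots> = (\<Sum>b\<in>B. \<integral>x. f (sigma_map R b x) \<partial>\<mu>) / of_nat (card B)"
    unfolding uniform_count_measure_def
    by (subst lebesgue_integral_point_measure_finite)
       (use finite_B in \<open>auto simp: sum_divide_distrib scaleR_conv_of_real\<close>)
  finally show ?thesis .
qed

end

section \<open>Exponentials and the Fourier transform of the invariant measure\<close>

lemma e_fun_commute: "e_fun s t = e_fun t s"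
  by (simp add: e_fun_def inner_commute)

lemma e_fun_add: "e_fun (s + t) x = e_fun s x * e_fun t x"
  by (simp add: e_fun_def inner_left_distrib exp_add[symmetric] algebra_simps)

lemma e_fun_add_right: "e_fun t (x + y) = e_fun t x * e_fun t y"
  by (metis e_fun_commute e_fun_add)

lemma e_fun_zero [simp]: "e_fun 0 x = 1" "e_fun t 0 = 1"
  by (simp_all add: e_fun_def)

lemma norm_e_fun [simp]: "cmod (e_fun t x) = 1"
  by (simp add: e_fun_def)

lemma cnj_e_fun: "cnj (e_fun t x) = e_fun (- t) x"
  by (simp add: e_fun_def exp_cnj)

lemma e_fun_diff: "e_fun (s - t) x = e_fun s x * cnj (e_fun t x)"
  using e_fun_add[of s "-t" x] by (simp add: cnj_e_fun)

lemma e_fun_Ints: "t \<bullet> x \<in> \<int> \<Longrightarrow> e_fun t x = 1"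
  by (auto simp: e_fun_def elim!: Ints_cases intro: exp_two_pi_i' simp: exp_eq_1)

lemma continuous_e_fun: "continuous_on UNIV (e_fun t)"
  unfolding e_fun_def by (intro continuous_intros)

lemma borel_measurable_e_fun [measurable]: "e_fun t \<in> borel_measurable borel"
  by (intro borel_measurable_continuous_onI continuous_e_fun)

section \<open>Closed subspaces of square-integrable functions\<close>

lemma cmod_add_squared_le: "(cmod (a + b))\<^sup>2 \<le> 2 * (cmod a)\<^sup>2 + 2 * (cmod b)\<^sup>2"
proof -
  have "(cmod (a + b))\<^sup>2 \<le> (cmod a + cmod b)\<^sup>2"
    by (intro power_mono norm_triangle_ineq) auto
  also have "\<dots> \<le> 2 * (cmod a)\<^sup>2 + 2 * (cmod b)\<^sup>2"
    using zero_le_power2[of "cmod a - cmod b"] by (simp add: power2_eq_square algebra_simps)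
  finally show ?thesis .
qed

lemma L2_spaceI:
  "f \<in> borel_measurable M \<Longrightarrow> integrable M (\<lambda>x. (cmod (f x))\<^sup>2) \<Longrightarrow> f \<in> L2_space M"
  by (simp add: L2_space_def)

lemma L2_space_measurable: "f \<in> L2_space M \<Longrightarrow> f \<in> borel_measurable M"
  by (simp add: L2_space_def)

lemma L2_space_integrable: "f \<in> L2_space M \<Longrightarrow> integrable M (\<lambda>x. (cmod (f x))\<^sup>2)"
  by (simp add: L2_space_def)

lemma L2_space_dominated:
  assumes [measurable]: "f \<in> borel_measurable M" and w: "integrable M (\<lambda>x. (w x)\<^sup>2)"
    and bound: "AE x in M. cmod (f x) \<le> w x"
  shows "f \<in> L2_space M"
proof (rule L2_spaceI)
  show "integrable M (\<lambda>x. (cmod (f x))\<^sup>2)"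
  proof (rule Bochner_Integration.integrable_bound[OF w])
    show "AE x in M. norm ((cmod (f x))\<^sup>2) \<le> norm ((w x)\<^sup>2)"
      using bound by eventually_elim (simp add: power_mono)
  qed measurable
qed measurable

lemma L2_space_scale: "f \<in> L2_space M \<Longrightarrow> (\<lambda>x. c * f x) \<in> L2_space M"
  by (auto simp: L2_space_def norm_mult power_mult_distrib)

lemma L2_space_add:
  assumes f: "f \<in> L2_space M" and g: "g \<in> L2_space M"
  shows "(\<lambda>x. f x + g x) \<in> L2_space M"
proof (rule L2_spaceI)
  have [measurable]: "f \<in> borel_measurable M" "g \<in> borel_measurable M"
    using f g by (auto intro: L2_space_measurable)
  show "integrable M (\<lambda>x. (cmod (f x + g x))\<^sup>2)"
  proof (rule Bochner_Integration.integrable_bound)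
    show "integrable M (\<lambda>x. 2 * (cmod (f x))\<^sup>2 + 2 * (cmod (g x))\<^sup>2)"
      using f g by (simp add: L2_space_integrable)
  qed (auto intro!: AE_I2 order_trans[OF cmod_add_squared_le])
  show "(\<lambda>x. f x + g x) \<in> borel_measurable M"
    by measurable
qed

lemma L2_space_diff: "f \<in> L2_space M \<Longrightarrow> g \<in> L2_space M \<Longrightarrow> (\<lambda>x. f x - g x) \<in> L2_space M"
  using L2_space_add[of f M "\<lambda>x. -1 * g x"] L2_space_scale[of g M "-1"] by simp

lemma L2_norm_less_iff: "0 < \<epsilon> \<Longrightarrow> L2_norm M f < \<epsilon> \<longleftrightarrow> (\<integral>x. (cmod (f x))\<^sup>2 \<partial>M) < \<epsilon>\<^sup>2"
  unfolding L2_norm_def by (metis less_eq_real_def real_sqrt_less_iff real_sqrt_unique)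

lemma L2_norm_add_less:
  assumes f: "f \<in> L2_space M" and g: "g \<in> L2_space M" and "0 < \<epsilon>"
    and "L2_norm M f < \<epsilon> / 2" "L2_norm M g < \<epsilon> / 2"
  shows "L2_norm M (\<lambda>x. f x + g x) < \<epsilon>"
proof -
  have "(\<integral>x. (cmod (f x + g x))\<^sup>2 \<partial>M) \<le> (\<integral>x. 2 * (cmod (f x))\<^sup>2 + 2 * (cmod (g x))\<^sup>2 \<partial>M)"
    using f g L2_space_integrable[OF L2_space_add[OF f g]]
    by (intro integral_mono cmod_add_squared_le) (simp_all add: L2_space_integrable)
  also have "\<dots> = 2 * (\<integral>x. (cmod (f x))\<^sup>2 \<partial>M) + 2 * (\<integral>x. (cmod (g x))\<^sup>2 \<partial>M)"
    using f g by (simp add: L2_space_integrable)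
  also have "\<dots> < 2 * (\<epsilon> / 2)\<^sup>2 + 2 * (\<epsilon> / 2)\<^sup>2"
    using assms L2_norm_less_iff[of "\<epsilon> / 2"] by (intro add_strict_mono) auto
  also have "\<dots> = \<epsilon>\<^sup>2" by (simp add: power2_eq_square)
  finally show ?thesis
    using L2_norm_less_iff \<open>0 < \<epsilon>\<close> by blast
qed

text \<open>Elements are functions and not classes, but closedness with respect to the seminorm makes \<open>W\<close>
  saturated under almost everywhere equality.\<close>

locale L2_subspace = prob_space M for M :: "'a measure" +
  fixes W :: "('a \<Rightarrow> complex) set"
  assumes subset_L2: "W \<subseteq> L2_space M"
    and zero: "(\<lambda>x. 0) \<in> W"
    and add: "f \<in> W \<Longrightarrow> g \<in> W \<Longrightarrow> (\<lambda>x. f x + g x) \<in> W"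
    and scale: "f \<in> W \<Longrightarrow> (\<lambda>x. c * f x) \<in> W"
    and closed: "f \<in> L2_space M \<Longrightarrow> (\<And>\<epsilon>. 0 < \<epsilon> \<Longrightarrow> \<exists>g\<in>W. L2_norm M (\<lambda>x. f x - g x) < \<epsilon>) \<Longrightarrow> f \<in> W"
begin

lemma diff: "f \<in> W \<Longrightarrow> g \<in> W \<Longrightarrow> (\<lambda>x. f x - g x) \<in> W"
  using add[of f "\<lambda>x. -1 * g x"] scale[of g "-1"] by simp

lemma sum: "(\<And>i. i \<in> I \<Longrightarrow> f i \<in> W) \<Longrightarrow> (\<lambda>x. \<Sum>i\<in>I. f i x) \<in> W"
  by (induction I rule: infinite_finite_induct) (auto intro: zero add)

text \<open>Domination by \<open>w\<close> bounds \<open>|g - f\<^sub>n|\<^sup>2\<close> by \<open>4 w\<^sup>2\<close>, so pointwise convergence is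
  convergence in \<open>L\<^sup>2\<close>.\<close>

lemma dominated_limit:
  assumes f: "\<And>n. f n \<in> W" and [measurable]: "g \<in> borel_measurable M"
    and lim: "AE x in M. (\<lambda>n. f n x) \<longlonglongrightarrow> g x"
    and bound: "\<And>n. AE x in M. cmod (f n x) \<le> w x"
    and w: "integrable M (\<lambda>x. (w x)\<^sup>2)"
  shows "g \<in> W"
proof (rule closed)
  have [measurable]: "f n \<in> borel_measurable M" for n
    using f subset_L2 L2_space_measurable by blast
  have all: "AE x in M. \<forall>n. cmod (f n x) \<le> w x"
    using bound by (simp add: AE_all_countable)
  with lim have g_le: "AE x in M. cmod (g x) \<le> w x"
    by eventually_elim (blast intro: Lim_norm_ubound[OF sequentially_bot] always_eventually)
  show "g \<in> L2_space M"
    using w g_le by (intro L2_space_dominated) auto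
  have lim2: "(\<lambda>n. \<integral>x. (cmod (g x - f n x))\<^sup>2 \<partial>M) \<longlonglongrightarrow> (\<integral>x. 0 \<partial>M)"
  proof (rule integral_dominated_convergence)
    show "integrable M (\<lambda>x. 4 * (w x)\<^sup>2)"
      using w by simp
    show "AE x in M. (\<lambda>n. (cmod (g x - f n x))\<^sup>2) \<longlonglongrightarrow> 0"
      using lim
    proof eventually_elim
      case (elim x)
      have "(\<lambda>n. (cmod (g x - f n x))\<^sup>2) \<longlonglongrightarrow> (cmod (g x - g x))\<^sup>2"
        by (intro tendsto_intros elim)
      then show ?case by simp
    qed
    show "AE x in M. norm ((cmod (g x - f n x))\<^sup>2) \<le> 4 * (w x)\<^sup>2" for n
      using all g_le
    proof eventually_elim
      case (elim x)
      have "cmod (g x - f n x) \<le> 2 * w x"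
        using elim norm_triangle_ineq4[of "g x" "f n x"] by (smt (verit))
      then have "(cmod (g x - f n x))\<^sup>2 \<le> (2 * w x)\<^sup>2"
        by (rule power_mono) simp
      then show ?case by (simp add: power_mult_distrib)
    qed
  qed measurable
  fix \<epsilon> :: real
  assume "0 < \<epsilon>"
  then have "eventually (\<lambda>n. (\<integral>x. (cmod (g x - f n x))\<^sup>2 \<partial>M) < \<epsilon>\<^sup>2) sequentially"
    using lim2 by (intro order_tendstoD(2)[OF lim2]) simp
  then obtain n where "(\<integral>x. (cmod (g x - f n x))\<^sup>2 \<partial>M) < \<epsilon>\<^sup>2"
    using eventually_happens' sequentially_bot by blast
  with \<open>0 < \<epsilon>\<close> f show "\<exists>h\<in>W. L2_norm M (\<lambda>x. g x - h x) < \<epsilon>"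
    using L2_norm_less_iff by blast
qed

lemma bounded_limit:
  assumes "\<And>n. f n \<in> W" "g \<in> borel_measurable M" "AE x in M. (\<lambda>n. f n x) \<longlonglongrightarrow> g x"
    and "\<And>n. AE x in M. cmod (f n x) \<le> K"
  shows "g \<in> W"
  using assms by (rule dominated_limit[where w = "\<lambda>_. K"]) simp

end

lemma complex_lin_span_zero: "(\<lambda>x. 0) \<in> complex_lin_span E"
  unfolding complex_lin_span_def by (rule CollectI, rule exI[of _ "{}"]) auto

lemma complex_lin_span_scale:
  assumes "f \<in> complex_lin_span E"
  shows "(\<lambda>x. k * f x) \<in> complex_lin_span E"
proof -
  obtain F c where F: "f = (\<lambda>x. \<Sum>g\<in>F. c g * g x)" "finite F" "F \<subseteq> E"
    using assms by (auto simp: complex_lin_span_def)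
  then have "(\<lambda>x. k * f x) = (\<lambda>x. \<Sum>g\<in>F. (k * c g) * g x)"
    by (simp add: sum_distrib_left mult.assoc)
  with F show ?thesis
    unfolding complex_lin_span_def
    by (intro CollectI exI[of _ F] exI[of _ "\<lambda>g. k * c g"]) simp
qed

lemma complex_lin_span_add:
  assumes "f \<in> complex_lin_span E" "g \<in> complex_lin_span E"
  shows "(\<lambda>x. f x + g x) \<in> complex_lin_span E"
proof -
  obtain F c where F: "f = (\<lambda>x. \<Sum>h\<in>F. c h * h x)" "finite F" "F \<subseteq> E"
    using assms by (auto simp: complex_lin_span_def)
  obtain G d where G: "g = (\<lambda>x. \<Sum>h\<in>G. d h * h x)" "finite G" "G \<subseteq> E"
    using assms by (auto simp: complex_lin_span_def)
  have "f x + g x = (\<Sum>h\<in>F \<union> G. ((if h \<in> F then c h else 0) + (if h \<in> G then d h else 0)) * h x)" for x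
  proof -
    have "f x = (\<Sum>h\<in>F \<union> G. (if h \<in> F then c h else 0) * h x)"
      unfolding F(1) using F G by (intro sum.mono_neutral_cong_left) auto
    moreover have "g x = (\<Sum>h\<in>F \<union> G. (if h \<in> G then d h else 0) * h x)"
      unfolding G(1) using F G by (intro sum.mono_neutral_cong_left) auto
    ultimately show ?thesis
      by (simp add: distrib_right sum.distrib)
  qed
  then show ?thesis
    unfolding complex_lin_span_def using F G
    by (intro CollectI exI[of _ "F \<union> G"] exI[of _ "\<lambda>h. (if h \<in> F then c h else 0) + (if h \<in> G then d h else 0)"])
       auto
qed

lemma complex_lin_span_base: "f \<in> E \<Longrightarrow> f \<in> complex_lin_span E"
  unfolding complex_lin_span_def
  by (intro CollectI exI[of _ "{f}"] exI[of _ "\<lambda>_. 1"]) auto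

lemma complex_lin_span_sum:
  "(\<And>i. i \<in> I \<Longrightarrow> f i \<in> complex_lin_span E) \<Longrightarrow> (\<lambda>x. \<Sum>i\<in>I. f i x) \<in> complex_lin_span E"
  by (induction I rule: infinite_finite_induct)
     (auto intro: complex_lin_span_zero complex_lin_span_add)

lemma complex_lin_span_subset_L2:
  assumes "E \<subseteq> L2_space M"
  shows "complex_lin_span E \<subseteq> L2_space M"
proof
  fix f assume "f \<in> complex_lin_span E"
  then obtain F c where F: "f = (\<lambda>x. \<Sum>g\<in>F. c g * g x)" "finite F" "F \<subseteq> E"
    by (auto simp: complex_lin_span_def)
  have "(\<lambda>x. \<Sum>g\<in>F. c g * g x) \<in> L2_space M"
    using F(2,3) assms
  proof (induction F rule: finite_induct)
    case empty
    then show ?case by (simp add: L2_space_def)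
  next
    case (insert g F)
    then show ?case
      by (auto intro!: L2_space_add L2_space_scale)
  qed
  with F show "f \<in> L2_space M" by simp
qed

lemma L2_subspace_closed_span:
  assumes "prob_space M" and E: "E \<subseteq> L2_space M"
  shows "L2_subspace M (L2_closed_span M E)"
proof -
  interpret prob_space M by fact
  let ?S = "complex_lin_span E"
  have S: "g \<in> L2_space M" if "g \<in> ?S" for g
    using complex_lin_span_subset_L2[OF E] that by blast
  have approx: "\<exists>g\<in>?S. L2_norm M (\<lambda>x. f x - g x) < \<epsilon>" if "f \<in> L2_closed_span M E" "0 < \<epsilon>" for f \<epsilon>
    using that by (auto simp: L2_closed_span_def)
  have L2: "f \<in> L2_space M" if "f \<in> L2_closed_span M E" for f
    using that by (auto simp: L2_closed_span_def)
  show ?thesis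
  proof unfold_locales
    show "L2_closed_span M E \<subseteq> L2_space M"
      using L2 by blast
    have "(\<lambda>x. 0) \<in> L2_space M"
      by (simp add: L2_space_def)
    moreover have "L2_norm M (\<lambda>x. 0 - 0) = 0"
      by (simp add: L2_norm_def)
    ultimately show "(\<lambda>x. 0) \<in> L2_closed_span M E"
      unfolding L2_closed_span_def using complex_lin_span_zero[of E]
      by (auto intro!: bexI[of _ "\<lambda>x. 0"])
  next
    fix f g assume f: "f \<in> L2_closed_span M E" and g: "g \<in> L2_closed_span M E"
    have "\<exists>h\<in>?S. L2_norm M (\<lambda>x. f x + g x - h x) < \<epsilon>" if \<epsilon>: "0 < \<epsilon>" for \<epsilon>
    proof -
      obtain f' g' where "f' \<in> ?S" "L2_norm M (\<lambda>x. f x - f' x) < \<epsilon> / 2"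
          and "g' \<in> ?S" "L2_norm M (\<lambda>x. g x - g' x) < \<epsilon> / 2"
        using approx[OF f, of "\<epsilon> / 2"] approx[OF g, of "\<epsilon> / 2"] \<epsilon> by auto
      moreover from this have "L2_norm M (\<lambda>x. (f x - f' x) + (g x - g' x)) < \<epsilon>"
        using f g \<epsilon> by (intro L2_norm_add_less L2_space_diff L2 S)
      ultimately show ?thesis
        by (intro bexI[OF _ complex_lin_span_add[of f' E g']]) (auto simp: algebra_simps)
    qed
    with f g show "(\<lambda>x. f x + g x) \<in> L2_closed_span M E"
      by (simp add: L2_closed_span_def L2_space_add)
  next
    fix f c assume f: "f \<in> L2_closed_span M E"
    have "\<exists>h\<in>?S. L2_norm M (\<lambda>x. c * f x - h x) < \<epsilon>" if \<epsilon>: "0 < \<epsilon>" for \<epsilon>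
    proof -
      obtain f' where f': "f' \<in> ?S" "L2_norm M (\<lambda>x. f x - f' x) < \<epsilon> / (1 + cmod c)"
        using approx[OF f, of "\<epsilon> / (1 + cmod c)"] \<epsilon> by (auto simp: add_pos_nonneg)
      have "L2_norm M (\<lambda>x. c * f x - c * f' x) = cmod c * L2_norm M (\<lambda>x. f x - f' x)"
        unfolding L2_norm_def right_diff_distrib[symmetric] norm_mult power_mult_distrib
        by (simp add: real_sqrt_mult)
      also have "\<dots> \<le> (1 + cmod c) * L2_norm M (\<lambda>x. f x - f' x)"
        by (intro mult_right_mono) (auto simp: L2_norm_def)
      also have "\<dots> < \<epsilon>"
        using f'(2) by (simp add: field_simps add_pos_nonneg)
      finally show ?thesis
        using complex_lin_span_scale[OF f'(1), of c] by (rule bexI)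
    qed
    with f show "(\<lambda>x. c * f x) \<in> L2_closed_span M E"
      by (simp add: L2_closed_span_def L2_space_scale)
  next
    fix f assume f: "f \<in> L2_space M"
      and lim: "\<And>\<epsilon>. 0 < \<epsilon> \<Longrightarrow> \<exists>g\<in>L2_closed_span M E. L2_norm M (\<lambda>x. f x - g x) < \<epsilon>"
    have "\<exists>h\<in>?S. L2_norm M (\<lambda>x. f x - h x) < \<epsilon>" if \<epsilon>: "0 < \<epsilon>" for \<epsilon>
    proof -
      obtain g where g: "g \<in> L2_closed_span M E" "L2_norm M (\<lambda>x. f x - g x) < \<epsilon> / 2"
        using lim[of "\<epsilon> / 2"] \<epsilon> by auto
      obtain h where h: "h \<in> ?S" "L2_norm M (\<lambda>x. g x - h x) < \<epsilon> / 2"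
        using approx[OF g(1), of "\<epsilon> / 2"] \<epsilon> by auto
      have "L2_norm M (\<lambda>x. (f x - g x) + (g x - h x)) < \<epsilon>"
        using f g h \<epsilon> by (intro L2_norm_add_less L2_space_diff) (auto intro: L2 S)
      with h show ?thesis by auto
    qed
    with f show "f \<in> L2_closed_span M E"
      by (simp add: L2_closed_span_def)
  qed
qed

section \<open>Density of the polynomials\<close>

text \<open>From polynomials to continuous functions by Stone--Weierstrass on the support, to indicators
  of closed sets by \<open>max 0 (1 - n dist(x, C))\<close>, to indicators of Borel sets by Dynkin's
  lemma, and to all of \<open>L\<^sup>2\<close> by monotone approximation.\<close>

lemma L2_subspace_polynomials_imp_all:
  fixes M :: "'a::euclidean_space measure"
  assumes "L2_subspace M W" and sets_M: "sets M = sets borel"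
    and support: "AE x in M. norm x \<le> r"
    and poly: "\<And>p. real_polynomial_function p \<Longrightarrow> (\<lambda>x. complex_of_real (p x)) \<in> W"
  shows "W = L2_space M"
proof -
  interpret L2_subspace M W by fact
  note W_add = add
  have space_M: "space M = UNIV"
    using sets_eq_imp_space_eq[OF sets_M] by simp
  have meas_M: "borel_measurable M = (borel_measurable borel :: ('a \<Rightarrow> 'b::topological_space) set)"
    by (rule measurable_cong_sets[OF sets_M refl])
  have cont: "(\<lambda>x. complex_of_real (h x)) \<in> W"
    if h: "continuous_on UNIV h" and K: "\<And>x. \<bar>h x\<bar> \<le> K" for h :: "'a \<Rightarrow> real" and K
  proof -
    have "\<exists>p. real_polynomial_function p \<and> (\<forall>x\<in>cball 0 r. \<bar>h x - p x\<bar> < 1 / Suc n)" for n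
      using Stone_Weierstrass_real_polynomial_function[of "cball 0 r" h "1 / Suc n"] h
      by (metis compact_cball continuous_on_subset divide_pos_pos of_nat_0_less_iff subset_UNIV
          zero_less_Suc zero_less_one)
    then obtain p where p: "\<And>n. real_polynomial_function (p n)"
        "\<And>n x. norm x \<le> r \<Longrightarrow> \<bar>h x - p n x\<bar> < 1 / Suc n"
      by (metis dist_0_norm mem_cball)
    show ?thesis
    proof (rule bounded_limit[where K = "K + 1"])
      show "(\<lambda>x. complex_of_real (p n x)) \<in> W" for n
        by (intro poly p)
      show "(\<lambda>x. complex_of_real (h x)) \<in> borel_measurable M"
        unfolding meas_M using h by (intro borel_measurable_continuous_onI continuous_intros)
      show "AE x in M. (\<lambda>n. complex_of_real (p n x)) \<longlonglongrightarrow> complex_of_real (h x)"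
        using support
      proof eventually_elim
        case (elim x)
        have "(\<lambda>n. p n x - h x) \<longlonglongrightarrow> 0"
        proof (rule tendsto_rabs_zero_cancel, rule tendsto_sandwich[OF _ _ tendsto_const LIMSEQ_Suc[OF lim_1_over_n]])
          show "\<forall>\<^sub>F n in sequentially. \<bar>p n x - h x\<bar> \<le> 1 / of_nat (Suc n)"
            using p(2)[OF elim] by (intro always_eventually allI) (simp add: abs_minus_commute less_imp_le)
        qed auto
        then have "(\<lambda>n. p n x) \<longlonglongrightarrow> h x"
          by (simp add: LIM_zero_iff)
        then show ?case by (rule tendsto_of_real)
      qed
      show "AE x in M. cmod (complex_of_real (p n x)) \<le> K + 1" for n
        using support
      proof eventually_elim
        case (elim x)
        have "1 / real (Suc n) \<le> 1" by simp
        then show ?case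
          using p(2)[OF elim, of n] K[of x] by (simp only: norm_of_real)
      qed
    qed
  qed
  have closed_ind: "(\<lambda>x. complex_of_real (indicator C x)) \<in> W" if C: "closed C" for C :: "'a set"
  proof (cases "C = {}")
    case True
    then show ?thesis by (simp add: zero)
  next
    case False
    define h where "h n x = max 0 (1 - real n * infdist x C)" for n x
    show ?thesis
    proof (rule bounded_limit[where K = 1])
      show "(\<lambda>x. complex_of_real (h n x)) \<in> W" for n
        unfolding h_def by (rule cont[of _ 1]) (auto intro!: continuous_intros simp: infdist_nonneg)
      show "(\<lambda>x. complex_of_real (indicator C x)) \<in> borel_measurable M"
        unfolding meas_M using borel_closed[OF C, measurable] by measurable
      show "AE x in M. (\<lambda>n. complex_of_real (h n x)) \<longlonglongrightarrow> complex_of_real (indicator C x)"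
      proof (intro AE_I2 tendsto_of_real)
        fix x
        show "(\<lambda>n. h n x) \<longlonglongrightarrow> indicator C x"
        proof (cases "x \<in> C")
          case True
          then show ?thesis by (simp add: h_def)
        next
          case nin: False
          then have pos: "0 < infdist x C"
            using C False by (intro infdist_pos_not_in_closed)
          obtain m where m: "1 < real m * infdist x C"
            using pos reals_Archimedean3 by blast
          have "h n x = 0" if "m \<le> n" for n
          proof -
            have "real m * infdist x C \<le> real n * infdist x C"
              using that pos by (intro mult_right_mono) auto
            with m show ?thesis by (simp add: h_def)
          qed
          then have "(\<lambda>n. h n x) \<longlonglongrightarrow> 0"
            by (intro tendsto_eventually eventually_sequentiallyI)
          with nin show ?thesis by simp
        qed
      qed
      show "AE x in M. cmod (complex_of_real (h n x)) \<le> 1" for n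
        by (intro AE_I2) (auto simp: h_def infdist_nonneg)
    qed
  qed
  have ind: "(\<lambda>x. complex_of_real (indicator A x)) \<in> W" if A: "A \<in> sets M" for A
  proof -
    have "Int_stable (Collect closed :: 'a set set)" "Collect closed \<subseteq> Pow (UNIV :: 'a set)"
        "A \<in> sigma_sets UNIV (Collect closed)"
      using A by (auto simp: Int_stable_def sets_M borel_eq_closed)
    then show ?thesis
    proof (induction A rule: sigma_sets_induct_disjoint)
      case (basic A)
      then show ?case by (auto intro: closed_ind)
    next
      case empty
      then show ?case by (simp add: zero)
    next
      case (compl A)
      have "(\<lambda>x. complex_of_real (indicator (UNIV :: 'a set) x)) \<in> W"
        by (rule closed_ind) simp
      from diff[OF this compl(2)] show ?case
        by (simp add: indicator_diff)
    next
      case (union A)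
      have eq: "(\<lambda>x. complex_of_real (indicator (\<Union>i<n. A i) x)) =
          (\<lambda>x. \<Sum>i<n. complex_of_real (indicator (A i) x))" for n
        using disjoint_family_on_mono[OF subset_UNIV union(1), of "{..<n}"]
        by (simp add: indicator_UN_disjoint)
      show ?case
      proof (rule bounded_limit[where K = 1])
        show "(\<lambda>x. complex_of_real (indicator (\<Union>i<n. A i) x)) \<in> W" for n
          unfolding eq by (intro sum union)
        have [measurable]: "(\<Union>i. A i) \<in> sets M"
          using union(2) by (auto simp: sets_M borel_eq_closed intro: sigma_sets.Union)
        show "(\<lambda>x. complex_of_real (indicator (\<Union>i. A i) x)) \<in> borel_measurable M"
          by measurable
        show "AE x in M. (\<lambda>n. complex_of_real (indicator (\<Union>i<n. A i) x)) \<longlonglongrightarrow>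
            complex_of_real (indicator (\<Union>i. A i) x)"
          by (intro AE_I2 tendsto_of_real LIMSEQ_indicator_UN)
      qed (auto simp: indicator_def)
    qed
  qed
  have nonneg: "integrable M (\<lambda>x. (u x)\<^sup>2) \<longrightarrow> (\<lambda>x. complex_of_real (u x)) \<in> W"
    if "u \<in> borel_measurable M" "\<And>x. 0 \<le> u x" for u
    using that
  proof (induction rule: borel_measurable_induct_real)
    case (set A)
    then show ?case using ind by simp
  next
    case (mult u c)
    then show ?case
      using scale[of "\<lambda>x. complex_of_real (u x)" "complex_of_real c"] zero
      by (cases "c = 0") (auto simp: power_mult_distrib)
  next
    case (add u v)
    show ?case
    proof
      assume int: "integrable M (\<lambda>x. (v x + u x)\<^sup>2)"
      have "integrable M (\<lambda>x. (v x)\<^sup>2)" "integrable M (\<lambda>x. (u x)\<^sup>2)"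
        using add by (auto intro!: Bochner_Integration.integrable_bound[OF int] power_mono)
      with add show "(\<lambda>x. complex_of_real (v x + u x)) \<in> W"
        using W_add[of "\<lambda>x. complex_of_real (v x)" "\<lambda>x. complex_of_real (u x)"] by simp
    qed
  next
    case (seq U)
    show ?case
    proof
      assume int: "integrable M (\<lambda>x. (u x)\<^sup>2)"
      have le: "U i x \<le> u x" for i x
      proof (rule incseq_le)
        show "incseq (\<lambda>i. U i x)"
          using seq.hyps(3) by (auto simp: incseq_def le_fun_def)
        show "(\<lambda>i. U i x) \<longlonglongrightarrow> u x"
          using seq.hyps(4) by (simp add: space_M)
      qed
      have "integrable M (\<lambda>x. (U i x)\<^sup>2)" for i
        using seq.hyps(1,2) le
        by (intro Bochner_Integration.integrable_bound[OF int]) (auto intro!: power_mono)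
      then have U: "(\<lambda>x. complex_of_real (U i x)) \<in> W" for i
        using seq.IH by blast
      show "(\<lambda>x. complex_of_real (u x)) \<in> W"
      proof (rule dominated_limit[OF U _ _ _ int])
        show "(\<lambda>x. complex_of_real (u x)) \<in> borel_measurable M"
          using that by measurable
        show "AE x in M. (\<lambda>i. complex_of_real (U i x)) \<longlonglongrightarrow> complex_of_real (u x)"
          by (intro AE_I2 tendsto_of_real seq.hyps)
        show "AE x in M. cmod (complex_of_real (U i x)) \<le> u x" for i
          using le seq.hyps(2) by simp
      qed
    qed
  qed
  have real: "(\<lambda>x. complex_of_real (u x)) \<in> W"
    if u [measurable]: "u \<in> borel_measurable M" and int: "integrable M (\<lambda>x. (u x)\<^sup>2)" for u
  proof -
    have part: "(\<lambda>x. complex_of_real (max 0 (c * u x))) \<in> W" if c: "c\<^sup>2 = 1" for c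
    proof -
      have "(max 0 (c * u x))\<^sup>2 \<le> (u x)\<^sup>2" for x
        using c by (simp add: max_def power_mult_distrib)
      then have "integrable M (\<lambda>x. (max 0 (c * u x))\<^sup>2)"
        by (intro Bochner_Integration.integrable_bound[OF int]) auto
      then show ?thesis
        using nonneg[of "\<lambda>x. max 0 (c * u x)"] by simp
    qed
    have "(\<lambda>x. complex_of_real (u x)) =
        (\<lambda>x. complex_of_real (max 0 (1 * u x)) - complex_of_real (max 0 (-1 * u x)))"
      by (auto simp: max_def)
    then show ?thesis
      using diff[OF part[of 1] part[of "-1"]] by simp
  qed
  have "f \<in> W" if f: "f \<in> L2_space M" for f
  proof -
    have [measurable]: "f \<in> borel_measurable M"
      using f by (rule L2_space_measurable)
    have int: "integrable M (\<lambda>x. (cmod (f x))\<^sup>2)"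
      using f by (rule L2_space_integrable)
    have Re: "(\<lambda>x. complex_of_real (Re (f x))) \<in> W"
      by (rule real, measurable, rule Bochner_Integration.integrable_bound[OF int])
         (auto intro!: AE_I2 simp: cmod_power2)
    have Im: "(\<lambda>x. complex_of_real (Im (f x))) \<in> W"
      by (rule real, measurable, rule Bochner_Integration.integrable_bound[OF int])
         (auto intro!: AE_I2 simp: cmod_power2)
    have "f = (\<lambda>x. complex_of_real (Re (f x)) + \<i> * complex_of_real (Im (f x)))"
      by (auto simp: complex_eq)
    then show ?thesis
      using add[OF Re scale[OF Im, of \<i>]] by simp
  qed
  then show ?thesis
    using subset_L2 by blast
qed

section \<open>Exponentials with frequencies in an open set\<close>

text \<open>Multiplication by \<open>u\<close> is an isometry of \<open>L\<^sup>2\<close>. With \<open>u\<close> an exponential this removes a fixed factor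
  \<open>e\<^sub>t\<close> in front of the polynomials.\<close>

lemma L2_subspace_unimodular_multiple:
  assumes "L2_subspace M W" and [measurable]: "u \<in> borel_measurable M" and u: "\<And>x. cmod (u x) = 1"
  shows "L2_subspace M {f \<in> L2_space M. (\<lambda>x. u x * f x) \<in> W}"
proof -
  interpret L2_subspace M W by fact
  have L2: "(\<lambda>x. u x * f x) \<in> L2_space M" if "f \<in> L2_space M" for f
    using that by (auto simp: L2_space_def norm_mult u)
  have norm: "L2_norm M (\<lambda>x. u x * f x - u x * g x) = L2_norm M (\<lambda>x. f x - g x)" for f g
    by (simp add: L2_norm_def right_diff_distrib[symmetric] norm_mult u)
  show ?thesis
  proof unfold_locales
    show "(\<lambda>x. 0) \<in> {f \<in> L2_space M. (\<lambda>x. u x * f x) \<in> W}"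
      using zero by (simp add: L2_space_def)
  next
    fix f g assume "f \<in> {f \<in> L2_space M. (\<lambda>x. u x * f x) \<in> W}" "g \<in> {f \<in> L2_space M. (\<lambda>x. u x * f x) \<in> W}"
    then show "(\<lambda>x. f x + g x) \<in> {f \<in> L2_space M. (\<lambda>x. u x * f x) \<in> W}"
      using add[of "\<lambda>x. u x * f x" "\<lambda>x. u x * g x"] by (simp add: L2_space_add distrib_left)
  next
    fix f c assume "f \<in> {f \<in> L2_space M. (\<lambda>x. u x * f x) \<in> W}"
    then show "(\<lambda>x. c * f x) \<in> {f \<in> L2_space M. (\<lambda>x. u x * f x) \<in> W}"
      using scale[of "\<lambda>x. u x * f x" c] by (simp add: L2_space_scale mult.left_commute)
  next
    fix f assume f: "f \<in> L2_space M"
      and lim: "\<And>\<epsilon>. 0 < \<epsilon> \<Longrightarrow> \<exists>g\<in>{f \<in> L2_space M. (\<lambda>x. u x * f x) \<in> W}. L2_norm M (\<lambda>x. f x - g x) < \<epsilon>"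
    have "(\<lambda>x. u x * f x) \<in> W"
    proof (rule closed[OF L2[OF f]])
      fix \<epsilon> :: real assume "0 < \<epsilon>"
      then obtain g where "(\<lambda>x. u x * g x) \<in> W" "L2_norm M (\<lambda>x. f x - g x) < \<epsilon>"
        using lim by blast
      then show "\<exists>h\<in>W. L2_norm M (\<lambda>x. u x * f x - h x) < \<epsilon>"
        by (intro bexI[of _ "\<lambda>x. u x * g x"]) (simp_all add: norm)
    qed
    with f show "f \<in> {f \<in> L2_space M. (\<lambda>x. u x * f x) \<in> W}" by simp
  qed auto
qed

lemma cmod_exp_i_minus_1_le: "cmod (exp (\<i> * complex_of_real \<theta>) - 1) \<le> \<bar>\<theta>\<bar>"
  using abs_sin_x_le_abs_x[of "\<theta> / 2"] by (simp add: dist_exp_i_1)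

lemma exp_difference_quotient_LIMSEQ:
  fixes z :: complex
  assumes s: "s \<longlonglongrightarrow> 0" and s0: "\<And>n. s n \<noteq> 0"
  shows "(\<lambda>n. (exp (z * complex_of_real (s n)) - 1) / complex_of_real (s n)) \<longlonglongrightarrow> z"
proof -
  have "((\<lambda>h. exp (z * h)) has_field_derivative z) (at 0)"
    by (auto intro!: derivative_eq_intros)
  then have *: "((\<lambda>h. (exp (z * h) - 1) / h) \<longlongrightarrow> z) (at 0)"
    by (simp add: DERIV_def)
  have "filterlim (\<lambda>n. complex_of_real (s n)) (at 0) sequentially"
    using tendsto_of_real[OF s, where 'a = complex] s0 by (simp add: filterlim_at)
  with * show ?thesis
    by (rule filterlim_compose)
qed

text \<open>Since \<open>e\<^sub>t g \<in> W\<close> for all \<open>t\<close> in an open set, the difference quotients of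
  \<open>t \<mapsto> e\<^sub>t g\<close> in a direction \<open>v\<close> lie in \<open>W\<close>, and on a bounded support they converge in \<open>L\<^sup>2\<close> to
  \<open>2\<pi>i (v \<bullet> x) e\<^sub>t g\<close>.\<close>

lemma L2_subspace_exponential_times_linear:
  fixes M :: "(real^'d) measure"
  assumes "L2_subspace M W" and sets_M: "sets M = sets borel"
    and support: "AE x in M. norm x \<le> r"
    and U: "open U" and g: "\<And>t. t \<in> U \<Longrightarrow> (\<lambda>x. e_fun t x * g x) \<in> W" and t: "t \<in> U"
  shows "(\<lambda>x. e_fun t x * (complex_of_real (v \<bullet> x) * g x)) \<in> W"
proof -
  interpret L2_subspace M W by fact
  have meas_M: "borel_measurable M = (borel_measurable borel :: (real^'d \<Rightarrow> 'b::topological_space) set)"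
    by (rule measurable_cong_sets[OF sets_M refl])
  have [measurable]: "e_fun s \<in> borel_measurable M" for s :: "real^'d"
    by (simp add: meas_M)
  have [measurable]: "(\<lambda>x. complex_of_real (v \<bullet> x)) \<in> borel_measurable M"
    unfolding meas_M by (intro borel_measurable_continuous_onI continuous_intros)
  have eg: "(\<lambda>x. e_fun t x * g x) \<in> L2_space M"
    using g[OF t] subset_L2 by blast
  then have int_g: "integrable M (\<lambda>x. (cmod (g x))\<^sup>2)"
    by (auto dest!: L2_space_integrable simp: norm_mult)
  have "(\<lambda>x. cnj (e_fun t x) * (e_fun t x * g x)) \<in> borel_measurable M"
    using L2_space_measurable[OF eg] by (simp add: cnj_e_fun)
  moreover have "cnj (e_fun t x) * (e_fun t x * g x) = g x" for x
    using e_fun_diff[of t t x] by (simp add: mult.assoc[symmetric] mult.commute[of "cnj _"])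
  ultimately have [measurable]: "g \<in> borel_measurable M" by simp
  obtain \<delta> where \<delta>: "0 < \<delta>" "ball t \<delta> \<subseteq> U"
    using U t open_contains_ball by blast
  \<comment> \<open>Step lengths so small that \<open>t + s n v\<close> stays in the ball; \<open>1 + |v|\<close> allows \<open>v = 0\<close>.\<close>
  define s where "s n = \<delta> / ((1 + norm v) * real (Suc n))" for n
  have s_pos: "0 < s n" for n
    using \<delta> by (simp add: s_def add_pos_nonneg)
  have s_lim: "s \<longlonglongrightarrow> 0"
  proof -
    have "(\<lambda>n. \<delta> / (1 + norm v) * (1 / real (Suc n))) \<longlonglongrightarrow> \<delta> / (1 + norm v) * 0"
      by (intro tendsto_intros LIMSEQ_Suc[OF lim_1_over_n])
    then show ?thesis by (simp add: s_def[abs_def])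
  qed
  have inU: "t + s n *\<^sub>R v \<in> U" for n
  proof -
    have "s n * norm v < \<delta>"
    proof -
      have "s n * norm v \<le> \<delta> / (1 + norm v) * norm v"
        using \<delta> unfolding s_def
        by (intro mult_right_mono divide_left_mono mult_pos_pos) (auto simp: add_pos_nonneg)
      also have "\<dots> < \<delta>"
        using \<delta> by (simp add: divide_less_eq add_pos_nonneg distrib_left)
      finally show ?thesis .
    qed
    then have "t + s n *\<^sub>R v \<in> ball t \<delta>"
      using s_pos[of n] by (simp add: dist_norm)
    with \<delta> show ?thesis by blast
  qed
  define F where "F n x = 1 / (\<i> * complex_of_real (2 * pi * s n)) *
      (e_fun (t + s n *\<^sub>R v) x * g x - e_fun t x * g x)" for n x
  have F: "F n x = e_fun t x * g x / (\<i> * complex_of_real (2 * pi)) *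
      ((exp (\<i> * complex_of_real (2 * pi * (v \<bullet> x)) * complex_of_real (s n)) - 1) / complex_of_real (s n))"
    for n x
    by (simp add: F_def e_fun_add e_fun_def[of "s n *\<^sub>R v"] field_simps)
  show ?thesis
  proof (rule dominated_limit)
    show "F n \<in> W" for n
      unfolding F_def by (intro scale diff g inU t)
    show "(\<lambda>x. e_fun t x * (complex_of_real (v \<bullet> x) * g x)) \<in> borel_measurable M"
      by measurable
    show "AE x in M. (\<lambda>n. F n x) \<longlonglongrightarrow> e_fun t x * (complex_of_real (v \<bullet> x) * g x)"
    proof (intro AE_I2)
      fix x
      let ?z = "\<i> * complex_of_real (2 * pi * (v \<bullet> x))"
      have "(\<lambda>n. F n x) \<longlonglongrightarrow> e_fun t x * g x / (\<i> * complex_of_real (2 * pi)) * ?z"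
        unfolding F using s_pos
        by (intro tendsto_mult tendsto_const exp_difference_quotient_LIMSEQ s_lim) (auto simp: less_le)
      then show "(\<lambda>n. F n x) \<longlonglongrightarrow> e_fun t x * (complex_of_real (v \<bullet> x) * g x)"
        by (simp add: field_simps)
    qed
    show "AE x in M. cmod (F n x) \<le> norm v * r * cmod (g x)" for n
      using support
    proof eventually_elim
      case (elim x)
      have "cmod (exp (\<i> * complex_of_real (2 * pi * (v \<bullet> x)) * complex_of_real (s n)) - 1)
          \<le> \<bar>2 * pi * (v \<bullet> x) * s n\<bar>"
        using cmod_exp_i_minus_1_le[of "2 * pi * (v \<bullet> x) * s n"] by (simp add: mult.assoc)
      also have "\<dots> = 2 * pi * s n * \<bar>v \<bullet> x\<bar>"
        using s_pos[of n] by (simp add: abs_mult)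
      also have "\<dots> \<le> 2 * pi * s n * (norm v * r)"
        using elim s_pos[of n] order_trans[OF Cauchy_Schwarz_ineq2[of v x] mult_left_mono[OF elim norm_ge_zero]]
        by (intro mult_left_mono) auto
      finally have le: "cmod (exp (\<i> * complex_of_real (2 * pi * (v \<bullet> x)) * complex_of_real (s n)) - 1)
          \<le> 2 * pi * s n * (norm v * r)" .
      have "cmod (F n x) = cmod (g x) / (2 * pi * s n) *
          cmod (exp (\<i> * complex_of_real (2 * pi * (v \<bullet> x)) * complex_of_real (s n)) - 1)"
        unfolding F using s_pos[of n] by (simp add: norm_mult norm_divide)
      also have "\<dots> \<le> cmod (g x) / (2 * pi * s n) * (2 * pi * s n * (norm v * r))"
        using s_pos[of n] by (intro mult_left_mono le) auto
      also have "\<dots> = norm v * r * cmod (g x)"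
        using s_pos[of n] by simp
      finally show ?case .
    qed
    show "integrable M (\<lambda>x. (norm v * r * cmod (g x))\<^sup>2)"
      using int_g by (simp add: power_mult_distrib)
  qed
qed

text \<open>Multiplication by a linear form preserves the property that \<open>e\<^sub>t g \<in> W\<close> for all \<open>t \<in> U\<close>, hence
  so does multiplication by any polynomial.\<close>

lemma L2_subspace_exponential_times_polynomial:
  fixes M :: "(real^'d) measure"
  assumes W: "L2_subspace M W" and sets_M: "sets M = sets borel"
    and support: "AE x in M. norm x \<le> r"
    and U: "open U" and exp: "\<And>t. t \<in> U \<Longrightarrow> e_fun t \<in> W"
    and p: "real_polynomial_function p" and t: "t \<in> U"
  shows "(\<lambda>x. e_fun t x * complex_of_real (p x)) \<in> W"
proof -
  interpret L2_subspace M W by fact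
  note W_add = add
  \<comment> \<open>The set of multipliers is closed under products because \<open>g\<close> is arbitrary.\<close>
  have "(\<lambda>x. e_fun t x * (complex_of_real (p x) * g x)) \<in> W"
    if "\<And>t. t \<in> U \<Longrightarrow> (\<lambda>x. e_fun t x * g x) \<in> W" "t \<in> U" for g t
    using p that
  proof (induction arbitrary: g t rule: real_polynomial_function.induct)
    case (linear f)
    have "f x = adjoint f 1 \<bullet> x" for x
      using adjoint_works[OF bounded_linear.linear[OF linear(1)], of x 1] by (simp add: inner_commute)
    then show ?case
      using L2_subspace_exponential_times_linear[OF W sets_M support U linear(2,3), of "adjoint f 1"]
      by simp
  next
    case (const c)
    then show ?case
      using scale[OF const(1)[OF const(2)], of "complex_of_real c"] by (simp add: mult.left_commute)
  next
    case (add f h)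
    have "(\<lambda>x. e_fun t x * (complex_of_real (f x) * g x) + e_fun t x * (complex_of_real (h x) * g x)) \<in> W"
      by (intro W_add add.IH add.prems)
    then show ?case by (simp add: algebra_simps)
  next
    case (mult f h)
    have "(\<lambda>x. e_fun t x * (complex_of_real (f x) * (complex_of_real (h x) * g x))) \<in> W"
      by (intro mult.IH mult.prems)
    then show ?case by (simp add: mult.assoc)
  qed
  from this[of "\<lambda>_. 1"] show ?thesis
    using exp t by simp
qed

text \<open>For a fixed \<open>t \<in> U\<close> the closed subspace \<open>{f. e\<^sub>t f \<in> W}\<close> contains all polynomials, so it is
  everything; and \<open>f = e\<^sub>t (e\<^sub>-\<^sub>t f)\<close>.\<close>

lemma L2_subspace_exponentials_imp_all:
  fixes M :: "(real^'d) measure"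
  assumes W: "L2_subspace M W" and sets_M: "sets M = sets borel"
    and support: "AE x in M. norm x \<le> r"
    and U: "open U" "U \<noteq> {}" and exp: "\<And>t. t \<in> U \<Longrightarrow> e_fun t \<in> W"
  shows "W = L2_space M"
proof -
  interpret L2_subspace M W by fact
  obtain t where t: "t \<in> U" using U by blast
  let ?V = "{f \<in> L2_space M. (\<lambda>x. e_fun t x * f x) \<in> W}"
  have e: "e_fun s \<in> borel_measurable M" for s :: "real^'d"
    by (simp add: measurable_cong_sets[OF sets_M refl])
  have L2: "(\<lambda>x. e_fun s x * f x) \<in> L2_space M \<longleftrightarrow> f \<in> L2_space M"
    if "f \<in> borel_measurable M" for f s
    using that e by (simp add: L2_space_def norm_mult)
  have cancel: "e_fun s x * (e_fun (- s) x * a) = a" for s x :: "real^'d" and a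
    using e_fun_add[of s "- s" x] by (simp add: mult.assoc[symmetric])
  have "?V = L2_space M"
  proof (rule L2_subspace_polynomials_imp_all[OF _ sets_M support])
    show "L2_subspace M ?V"
      by (rule L2_subspace_unimodular_multiple[OF W e norm_e_fun])
    fix p :: "real^'d \<Rightarrow> real" assume p: "real_polynomial_function p"
    have "(\<lambda>x. e_fun t x * complex_of_real (p x)) \<in> W"
      by (rule L2_subspace_exponential_times_polynomial[OF W sets_M support U(1) exp p t])
    moreover have "(\<lambda>x. complex_of_real (p x)) \<in> borel_measurable M"
      using continuous_on_polymonial_function[OF p[unfolded real_polynomial_function_eq]]
      unfolding measurable_cong_sets[OF sets_M refl]
      by (intro borel_measurable_continuous_onI continuous_intros)
    ultimately show "(\<lambda>x. complex_of_real (p x)) \<in> ?V"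
      using L2[of "\<lambda>x. complex_of_real (p x)" t] subsetD[OF subset_L2] by simp
  qed
  have "f \<in> W" if f: "f \<in> L2_space M" for f
  proof -
    have "(\<lambda>x. e_fun (- t) x * f x) \<in> ?V"
      using f L2[OF L2_space_measurable[OF f], of "- t"] \<open>?V = L2_space M\<close> by simp
    then show ?thesis
      by (simp add: cancel)
  qed
  with subset_L2 show ?thesis by blast
qed

section \<open>Frequencies and orthogonality\<close>

lemma inner_transpose_right: "x \<bullet> (transpose A *v y) = (A *v x) \<bullet> y"
  for A :: "real^'n^'m"
  by (metis inner_commute inner_transpose)

text \<open>The sums \<open>\<Sum>k<n. R\<^sup>*\<^sup>k l\<^sub>k\<close> in Horner form, which exposes the leading digit \<open>l\<^sub>0\<close> for inductions.\<close>

fun digit_sums :: "real^'d^'d \<Rightarrow> (real^'d) set \<Rightarrow> nat \<Rightarrow> (real^'d) set" where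
  "digit_sums R L 0 = {0}"
| "digit_sums R L (Suc n) = (\<lambda>(l, m). l + transpose R *v m) ` (L \<times> digit_sums R L n)"

lemma sum_mat_pow_vec_in_digit_sums:
  assumes "\<forall>k\<le>n. l k \<in> L"
  shows "(\<Sum>k=0..n. mat_pow_vec (transpose R) k (l k)) \<in> digit_sums R L (Suc n)"
  using assms
proof (induction n arbitrary: l)
  case 0
  then show ?case
    by (auto simp del: transpose_matrix_vector intro!: image_eqI[where x = "(l 0, 0)"])
next
  case (Suc n)
  have "(\<Sum>k=0..Suc n. mat_pow_vec (transpose R) k (l k)) =
      l 0 + transpose R *v (\<Sum>k=0..n. mat_pow_vec (transpose R) k (l (Suc k)))"
    by (subst sum.atLeast0_atMost_Suc_shift)
       (simp add: vec.linear_sum[OF matrix_vector_mul_linear_gen] del: transpose_matrix_vector)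
  moreover have "(\<Sum>k=0..n. mat_pow_vec (transpose R) k (l (Suc k))) \<in> digit_sums R L (Suc n)"
    using Suc.prems by (intro Suc.IH) simp
  moreover have "l 0 \<in> L"
    using Suc.prems by simp
  ultimately show ?case
    by (subst digit_sums.simps) (rule image_eqI[where x = "(l 0, \<Sum>k=0..n. mat_pow_vec (transpose R) k (l (Suc k)))"], simp_all del: digit_sums.simps transpose_matrix_vector)
qed

lemma digit_sums_Suc_obtain:
  assumes "x \<in> digit_sums R L (Suc n)"
  shows "\<exists>l. (\<forall>k\<le>n. l k \<in> L) \<and> x = (\<Sum>k=0..n. mat_pow_vec (transpose R) k (l k))"
  using assms
proof (induction n arbitrary: x)
  case 0
  then show ?case by (auto intro!: exI[of _ "\<lambda>_. x"])
next
  case (Suc n)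
  then obtain d m where d: "d \<in> L" "m \<in> digit_sums R L (Suc n)" "x = d + transpose R *v m"
    by (subst (asm) digit_sums.simps(2)) (auto simp del: digit_sums.simps transpose_matrix_vector)
  then obtain l where l: "\<forall>k\<le>n. l k \<in> L" "m = (\<Sum>k=0..n. mat_pow_vec (transpose R) k (l k))"
    using Suc.IH by blast
  let ?l = "\<lambda>k. case k of 0 \<Rightarrow> d | Suc j \<Rightarrow> l j"
  have "(\<Sum>k=0..Suc n. mat_pow_vec (transpose R) k (?l k)) = x"
    unfolding d(3) l(2)
    by (subst sum.atLeast0_atMost_Suc_shift)
       (simp add: vec.linear_sum[OF matrix_vector_mul_linear_gen] del: transpose_matrix_vector)
  moreover have "\<forall>k\<le>Suc n. ?l k \<in> L"
    using d l by (auto split: nat.split)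
  ultimately show ?case by metis
qed

locale hadamard_system =
  fixes R :: "real^'d^'d" and B L :: "(real^'d) set" and \<mu> :: "(real^'d) measure"
  assumes expansive_R: "expansive R"
    and finite_B: "finite B" and finite_L: "finite L" and card_eq: "card B = card L"
    and integral_pairing: "\<And>n b l. 1 \<le> n \<Longrightarrow> b \<in> B \<Longrightarrow> l \<in> L \<Longrightarrow> mat_pow_vec R n b \<bullet> l \<in> \<int>"
    and unitary: "unitary_on B L (H_matrix B)"
    and zero_in_L: "0 \<in> L"
    and invariant: "invariant_measure R B \<mu>"
begin

abbreviation "RT \<equiv> transpose R"
abbreviation "RT_inv \<equiv> matrix_inv (transpose R)"
abbreviation "\<Lambda> \<equiv> frequencies R L"

sublocale prob_space \<mu>
  using invariant by (simp add: invariant_measure_def)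

lemma card_B_pos: "0 < card B"
  using finite_L zero_in_L card_eq by (auto simp: card_gt_0_iff)

lemma B_nonempty: "B \<noteq> {}"
  using card_B_pos by auto

lemma sets_\<mu>: "sets \<mu> = sets borel"
  by (rule sets_invariant_measure[OF finite_B B_nonempty invariant])

lemma measurable_e_fun_\<mu> [measurable]: "e_fun t \<in> borel_measurable \<mu>"
  by (simp add: measurable_cong_sets[OF sets_\<mu> refl])

lemma RT_inv_RT [simp]: "RT_inv *v (RT *v v) = v"
proof -
  have "invertible RT"
    using expansive_invertible[OF expansive_R] by (rule transpose_invertible)
  then show ?thesis
    by (simp add: matrix_vector_mul_assoc matrix_inv_mult del: transpose_matrix_vector)
qed

declare transpose_matrix_vector [simp del]

lemma digit_sums_subset_Suc: "digit_sums R L n \<subseteq> digit_sums R L (Suc n)"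
proof (induction n)
  case 0
  show ?case
    using zero_in_L by (auto intro!: image_eqI[where x = "(0, 0)"])
next
  case (Suc n)
  then show ?case by (subst (1 2) digit_sums.simps(2)) (auto simp del: digit_sums.simps)
qed

lemma digit_sums_mono: "m \<le> n \<Longrightarrow> digit_sums R L m \<subseteq> digit_sums R L n"
  by (rule lift_Suc_mono_le[where f = "digit_sums R L", OF digit_sums_subset_Suc])

lemma frequencies_eq_digit_sums: "\<Lambda> = (\<Union>n. digit_sums R L n)"
proof (intro equalityI subsetI)
  fix x assume "x \<in> \<Lambda>"
  then show "x \<in> (\<Union>n. digit_sums R L n)"
    unfolding frequencies_def using sum_mat_pow_vec_in_digit_sums[of _ _ L R] by blast
next
  fix x assume "x \<in> (\<Union>n. digit_sums R L n)"
  then obtain n where "x \<in> digit_sums R L n" by blast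
  \<comment> \<open>A frequency has at least two digits; the digit \<open>0\<close> serves as padding.\<close>
  then have "x \<in> digit_sums R L (Suc (Suc n))"
    using digit_sums_mono[of n "Suc (Suc n)"] by auto
  then obtain l where "\<forall>k\<le>Suc n. l k \<in> L" "x = (\<Sum>k=0..Suc n. mat_pow_vec RT k (l k))"
    using digit_sums_Suc_obtain by blast
  then show "x \<in> \<Lambda>"
    unfolding frequencies_def by (intro CollectI exI[of _ "Suc n"] exI[of _ l]) simp
qed

lemma zero_in_frequencies: "0 \<in> \<Lambda>"
  unfolding frequencies_eq_digit_sums by (rule UN_I[of 0]) auto

lemma frequencies_eq_image: "\<Lambda> = (\<lambda>(l, m). l + RT *v m) ` (L \<times> \<Lambda>)"
proof -
  have "\<Lambda> = (\<Union>n. digit_sums R L (Suc n))"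
    unfolding frequencies_eq_digit_sums using digit_sums_subset_Suc by blast
  also have "\<dots> = (\<lambda>(l, m). l + RT *v m) ` (L \<times> (\<Union>n. digit_sums R L n))"
    unfolding digit_sums.simps by blast
  finally show ?thesis
    unfolding frequencies_eq_digit_sums .
qed

text \<open>Moving \<open>R\<^sup>*\<close> to the other side of the inner product turns a further digit into a higher power
  of \<open>R\<close> acting on \<open>b\<close>.\<close>

lemma integral_pairing_frequencies:
  assumes "m \<in> \<Lambda>" "b \<in> B" "1 \<le> k"
  shows "mat_pow_vec R k b \<bullet> m \<in> \<int>"
proof -
  obtain n where "m \<in> digit_sums R L n"
    using assms(1) frequencies_eq_digit_sums by blast
  then show ?thesis
    using assms(3)
  proof (induction n arbitrary: m k)
    case 0
    then show ?case by simp
  next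
    case (Suc n)
    then obtain l m' where l: "l \<in> L" "m' \<in> digit_sums R L n" "m = l + RT *v m'"
      by auto
    have "mat_pow_vec R k b \<bullet> m = mat_pow_vec R k b \<bullet> l + mat_pow_vec R (Suc k) b \<bullet> m'"
      unfolding l(3) inner_add_right
      by (simp add: inner_transpose_right)
    then show ?case
      using Suc.IH[OF l(2), of "Suc k"] integral_pairing[OF Suc.prems(2) assms(2) l(1)] by simp
  qed
qed

lemma e_fun_frequency: "m \<in> \<Lambda> \<Longrightarrow> b \<in> B \<Longrightarrow> e_fun b (RT *v m) = 1"
proof (rule e_fun_Ints)
  assume "m \<in> \<Lambda>" "b \<in> B"
  then show "b \<bullet> (RT *v m) \<in> \<int>"
    using integral_pairing_frequencies[of m b 1]
    by (simp add: inner_transpose_right)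
qed

lemma chi_fun_periodic:
  assumes "m \<in> \<Lambda>"
  shows "chi_fun B (t + RT *v m) = chi_fun B t" "chi_fun B (t - RT *v m) = chi_fun B t"
proof -
  show *: "chi_fun B (t + RT *v m) = chi_fun B t" for t
    using assms by (simp add: chi_fun_def e_fun_add_right e_fun_frequency)
  show "chi_fun B (t - RT *v m) = chi_fun B t"
    using *[of "t - RT *v m"] by simp
qed

lemma chi_fun_zero [simp]: "chi_fun B 0 = 1"
  using card_B_pos by (simp add: chi_fun_def)

lemma H_matrix_mult:
  "H_matrix B b l * cnj (H_matrix B b' l') = e_fun b l * cnj (e_fun b' l') / of_nat (card B)"
proof -
  have "complex_of_real (sqrt (real (card B))) * complex_of_real (sqrt (real (card B))) = of_nat (card B)"
    by (simp flip: of_real_mult)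
  then show ?thesis
    by (simp add: H_matrix_def)
qed

text \<open>The columns of the matrix \<open>H\<close> are orthonormal.\<close>

lemma chi_fun_digit_difference:
  assumes "l \<in> L" "l' \<in> L"
  shows "chi_fun B (l - l') = (if l = l' then 1 else 0)"
proof -
  have "chi_fun B (l - l') = (\<Sum>b\<in>B. H_matrix B b l * cnj (H_matrix B b l'))"
    unfolding chi_fun_def H_matrix_mult sum_divide_distrib
    by (intro sum.cong refl) (metis e_fun_commute e_fun_diff)
  also have "\<dots> = (if l' = l then 1 else 0)"
    using unitary assms unfolding unitary_on_def by (simp add: mult.commute)
  finally show ?thesis by auto
qed

text \<open>The rows of \<open>H\<close> are orthonormal, so in the expansion of the squares all terms with \<open>b \<noteq> b'\<close>
  cancel. This is the identity \<open>C 1 = 1\<close>.\<close>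

lemma sum_cmod_chi_fun_squared: "(\<Sum>l\<in>L. (cmod (chi_fun B (t - l)))\<^sup>2) = 1"
proof -
  let ?N = "of_nat (card B) :: complex"
  have e: "e_fun b (t - l) = e_fun b t * cnj (e_fun b l)" for b l
    by (metis e_fun_commute e_fun_diff)
  have "complex_of_real (\<Sum>l\<in>L. (cmod (chi_fun B (t - l)))\<^sup>2) = (\<Sum>l\<in>L. chi_fun B (t - l) * cnj (chi_fun B (t - l)))"
    by (simp add: complex_mult_cnj cmod_power2)
  also have "\<dots> = (\<Sum>l\<in>L. (\<Sum>b\<in>B. \<Sum>b'\<in>B. e_fun b (t - l) * cnj (e_fun b' (t - l))) / ?N\<^sup>2)"
    by (simp add: chi_fun_def sum_product power2_eq_square)
  also have "\<dots> = (\<Sum>l\<in>L. \<Sum>b\<in>B. \<Sum>b'\<in>B. e_fun b t * cnj (e_fun b' t) / ?N * (H_matrix B b' l * cnj (H_matrix B b l)))"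
    unfolding H_matrix_mult sum_divide_distrib
    by (intro sum.cong refl) (simp add: e power2_eq_square)
  also have "\<dots> = (\<Sum>b\<in>B. \<Sum>b'\<in>B. e_fun b t * cnj (e_fun b' t) / ?N * (\<Sum>l\<in>L. H_matrix B b' l * cnj (H_matrix B b l)))"
    unfolding sum_distrib_left by (subst sum.swap, rule sum.cong[OF refl], rule sum.swap)
  also have "\<dots> = (\<Sum>b\<in>B. \<Sum>b'\<in>B. e_fun b t * cnj (e_fun b' t) / ?N * (if b' = b then 1 else 0))"
    using unitary unfolding unitary_on_def by (intro sum.cong refl) simp
  also have "\<dots> = (\<Sum>b\<in>B. e_fun b t * cnj (e_fun b t) / ?N)"
    using finite_B by (intro sum.cong refl) (simp add: if_distrib sum.delta cong: if_cong)
  also have "\<dots> = 1"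
    using e_fun_diff[of t t, symmetric] card_B_pos by (simp add: e_fun_commute[of _ t])
  finally show ?thesis
    using of_real_eq_1_iff by blast
qed

text \<open>The Fourier transform of the invariance equation.\<close>

lemma mu_hat_refinement: "mu_hat \<mu> t = cnj (chi_fun B t) * mu_hat \<mu> (RT_inv *v t)"
proof -
  have inv: "RT_inv = transpose (matrix_inv R)"
    by (rule matrix_inv_transpose[OF expansive_invertible[OF expansive_R]])
  have e: "e_fun t (sigma_map R b x) = e_fun t b * e_fun (RT_inv *v t) x" for b x
    by (simp add: sigma_map_def e_fun_add_right) (simp add: e_fun_def inv inner_transpose)
  have "mu_hat \<mu> t = (\<Sum>b\<in>B. \<integral>x. cnj (e_fun t (sigma_map R b x)) \<partial>\<mu>) / of_nat (card B)"
    unfolding mu_hat_def cnj_e_fun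
    by (rule integral_invariant_measure[OF finite_B B_nonempty invariant, where K = 1]) simp_all
  also have "\<dots> = (\<Sum>b\<in>B. cnj (e_fun t b) * mu_hat \<mu> (RT_inv *v t)) / of_nat (card B)"
    by (simp add: e mu_hat_def)
  also have "\<dots> = cnj (chi_fun B t) * mu_hat \<mu> (RT_inv *v t)"
    by (simp add: chi_fun_def sum_distrib_right e_fun_commute[of _ t])
  finally show ?thesis .
qed

lemma mu_hat_zero [simp]: "mu_hat \<mu> 0 = 1"
  by (simp add: mu_hat_def prob_space)

lemma mu_hat_minus: "mu_hat \<mu> (- t) = cnj (mu_hat \<mu> t)"
proof -
  have "mu_hat \<mu> (- t) = (\<integral>x. cnj (cnj (e_fun t x)) \<partial>\<mu>)"
    by (simp add: mu_hat_def cnj_e_fun)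
  also have "\<dots> = cnj (mu_hat \<mu> t)"
    unfolding mu_hat_def by (simp only: Bochner_Integration.integral_cnj)
  finally show ?thesis .
qed

lemma mu_hat_shift:
  assumes "l \<in> L" "m \<in> \<Lambda>"
  shows "mu_hat \<mu> (t - (l + RT *v m)) = cnj (chi_fun B (t - l)) * mu_hat \<mu> (rho_map R l t - m)"
proof -
  have "RT_inv *v ((t - l) - RT *v m) = rho_map R l t - m"
    by (simp add: rho_map_def matrix_vector_mult_diff_distrib)
  then have "mu_hat \<mu> ((t - l) - RT *v m) = cnj (chi_fun B (t - l)) * mu_hat \<mu> (rho_map R l t - m)"
    using mu_hat_refinement[of "(t - l) - RT *v m"] chi_fun_periodic(2)[OF assms(2), of "t - l"] by simp
  then show ?thesis
    by (simp add: diff_diff_eq)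
qed

text \<open>The function \<open>\<chi>\<^sub>B\<close> is unchanged when \<open>R\<^sup>* m\<close> is added and separates the digits, so \<open>l + R\<^sup>* m\<close>
  determines \<open>l\<close>, and then \<open>m\<close> because \<open>R\<^sup>*\<close> is invertible.\<close>

lemma inj_on_digit_expansion: "inj_on (\<lambda>(l, m). l + RT *v m) (L \<times> \<Lambda>)"
proof (intro inj_onI, clarify)
  fix l m l' m'
  assume *: "l \<in> L" "m \<in> \<Lambda>" "l' \<in> L" "m' \<in> \<Lambda>" "l + RT *v m = l' + RT *v m'"
  have "l - l' = 0 + RT *v m' - RT *v m"
    using *(5) by (simp add: algebra_simps)
  then have "chi_fun B (l - l') = chi_fun B 0"
    using *(2,4) chi_fun_periodic by metis
  then have l: "l = l'"
    using chi_fun_digit_difference[OF *(1,3)] by (auto split: if_splits)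
  then have "RT_inv *v (RT *v m) = RT_inv *v (RT *v m')"
    using *(5) by simp
  with l show "l = l' \<and> m = m'" by simp
qed

text \<open>Compare the expansions digit by digit. Equal leading digits are removed by the refinement
  equation; the first difference \<open>l \<noteq> l'\<close> contributes the factor \<open>\<chi>\<^sub>B(l - l') = 0\<close>.\<close>

lemma mu_hat_orthogonal:
  assumes "x \<in> \<Lambda>" "y \<in> \<Lambda>" "x \<noteq> y"
  shows "mu_hat \<mu> (x - y) = 0"
proof -
  obtain m n where "x \<in> digit_sums R L m" "y \<in> digit_sums R L n"
    using assms frequencies_eq_digit_sums by blast
  then have "x \<in> digit_sums R L (max m n)" "y \<in> digit_sums R L (max m n)"
    using digit_sums_mono max.cobounded1 max.cobounded2 by blast+
  then show ?thesis
    using assms(3)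
  proof (induction "max m n" arbitrary: x y m n)
    case 0
    then show ?case by simp
  next
    case (Suc k)
    have "x \<in> digit_sums R L (Suc k)" "y \<in> digit_sums R L (Suc k)"
      using Suc.prems(1,2) Suc.hyps(2) by simp_all
    then obtain l p l' p' where x: "l \<in> L" "p \<in> digit_sums R L k" "x = l + RT *v p"
        and y: "l' \<in> L" "p' \<in> digit_sums R L k" "y = l' + RT *v p'"
      by auto
    have p: "p \<in> \<Lambda>" "p' \<in> \<Lambda>"
      using x y frequencies_eq_digit_sums by blast+
    have "x - y = (l - l') + RT *v p - RT *v p'"
      by (simp add: x y)
    then have chi: "chi_fun B (x - y) = chi_fun B (l - l')"
      using chi_fun_periodic p by metis
    show ?case
    proof (cases "l = l'")
      case True
      then have "RT_inv *v (x - y) = p - p'"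
        by (simp add: x y matrix_vector_mult_diff_distrib)
      moreover have "p \<noteq> p'"
        using True x y Suc.prems(3) by auto
      then have "mu_hat \<mu> (p - p') = 0"
        using Suc.hyps(1)[of k k p p'] x y by simp
      ultimately show ?thesis
        using mu_hat_refinement[of "x - y"] by simp
    next
      case False
      then show ?thesis
        using mu_hat_refinement[of "x - y"] chi chi_fun_digit_difference[OF x(1) y(1)] by simp
    qed
  qed
qed

section \<open>Bessel's inequality and the function Q\<close>

lemma integrable_e_fun_mult: "integrable \<mu> (\<lambda>x. e_fun s x * cnj (e_fun t x))"
  unfolding cnj_e_fun
  by (rule integrable_const_bound[where B = 1]) (auto simp: norm_mult)

lemma integral_e_fun_mult: "(\<integral>x. e_fun s x * cnj (e_fun t x) \<partial>\<mu>) = mu_hat \<mu> (t - s)"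
  unfolding e_fun_diff[symmetric] unfolding mu_hat_def cnj_e_fun by simp

text \<open>By orthonormality, subtracting the orthogonal projection onto finitely many exponentials removes
  exactly the squares of the Fourier coefficients.\<close>

lemma norm_residual_squared:
  assumes F: "finite F" "F \<subseteq> \<Lambda>"
  shows "(\<integral>x. (cmod (e_fun t x - (\<Sum>s\<in>F. mu_hat \<mu> (s - t) * e_fun s x)))\<^sup>2 \<partial>\<mu>)
    = 1 - (\<Sum>s\<in>F. (cmod (mu_hat \<mu> (t - s)))\<^sup>2)"
proof -
  define c where "c s = mu_hat \<mu> (s - t)" for s
  have c': "mu_hat \<mu> (t - s) = cnj (c s)" for s
    using mu_hat_minus[of "s - t"] by (simp add: c_def)
  note [simp] = integrable_e_fun_mult integral_e_fun_mult
  have "complex_of_real ((cmod (e_fun t x - (\<Sum>s\<in>F. c s * e_fun s x)))\<^sup>2) =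
      e_fun t x * cnj (e_fun t x)
      - (\<Sum>s\<in>F. cnj (c s) * (e_fun t x * cnj (e_fun s x)))
      - (\<Sum>s\<in>F. c s * (e_fun s x * cnj (e_fun t x)))
      + (\<Sum>s\<in>F. \<Sum>r\<in>F. c s * cnj (c r) * (e_fun s x * cnj (e_fun r x)))" for x
  proof -
    have "complex_of_real ((cmod (e_fun t x - (\<Sum>s\<in>F. c s * e_fun s x)))\<^sup>2) =
        (e_fun t x - (\<Sum>s\<in>F. c s * e_fun s x)) * cnj (e_fun t x - (\<Sum>s\<in>F. c s * e_fun s x))"
      by (simp only: complex_mult_cnj cmod_power2)
    also have "\<dots> = e_fun t x * cnj (e_fun t x) - e_fun t x * (\<Sum>s\<in>F. cnj (c s * e_fun s x))
        - (\<Sum>s\<in>F. c s * e_fun s x) * cnj (e_fun t x)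
        + (\<Sum>s\<in>F. c s * e_fun s x) * (\<Sum>s\<in>F. cnj (c s * e_fun s x))"
      by (simp add: algebra_simps)
    also have "e_fun t x * (\<Sum>s\<in>F. cnj (c s * e_fun s x)) = (\<Sum>s\<in>F. cnj (c s) * (e_fun t x * cnj (e_fun s x)))"
      unfolding sum_distrib_left by (intro sum.cong refl) simp
    also have "(\<Sum>s\<in>F. c s * e_fun s x) * cnj (e_fun t x) = (\<Sum>s\<in>F. c s * (e_fun s x * cnj (e_fun t x)))"
      unfolding sum_distrib_right by (intro sum.cong refl) simp
    also have "(\<Sum>s\<in>F. c s * e_fun s x) * (\<Sum>s\<in>F. cnj (c s * e_fun s x)) =
        (\<Sum>s\<in>F. \<Sum>r\<in>F. c s * cnj (c r) * (e_fun s x * cnj (e_fun r x)))"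
      unfolding sum_product by (intro sum.cong refl) simp
    finally show ?thesis .
  qed
  then have "complex_of_real (\<integral>x. (cmod (e_fun t x - (\<Sum>s\<in>F. c s * e_fun s x)))\<^sup>2 \<partial>\<mu>) =
      (\<integral>x. e_fun t x * cnj (e_fun t x)
      - (\<Sum>s\<in>F. cnj (c s) * (e_fun t x * cnj (e_fun s x)))
      - (\<Sum>s\<in>F. c s * (e_fun s x * cnj (e_fun t x)))
      + (\<Sum>s\<in>F. \<Sum>r\<in>F. c s * cnj (c r) * (e_fun s x * cnj (e_fun r x))) \<partial>\<mu>)"
    by (simp flip: integral_complex_of_real)
  also have "\<dots> = mu_hat \<mu> (t - t) - (\<Sum>s\<in>F. cnj (c s) * mu_hat \<mu> (s - t))
      - (\<Sum>s\<in>F. c s * mu_hat \<mu> (t - s)) + (\<Sum>s\<in>F. \<Sum>r\<in>F. c s * cnj (c r) * mu_hat \<mu> (r - s))"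
    by simp
  also have "(\<Sum>s\<in>F. \<Sum>r\<in>F. c s * cnj (c r) * mu_hat \<mu> (r - s)) = (\<Sum>s\<in>F. c s * cnj (c s))"
  proof (intro sum.cong refl)
    fix s assume s: "s \<in> F"
    have "(\<Sum>r\<in>F. c s * cnj (c r) * mu_hat \<mu> (r - s)) = (\<Sum>r\<in>F. if r = s then c s * cnj (c s) else 0)"
      using s F by (intro sum.cong refl) (auto simp: mu_hat_orthogonal subset_iff)
    then show "(\<Sum>r\<in>F. c s * cnj (c r) * mu_hat \<mu> (r - s)) = c s * cnj (c s)"
      using s F by simp
  qed
  also have "mu_hat \<mu> (t - t) - (\<Sum>s\<in>F. cnj (c s) * mu_hat \<mu> (s - t))
      - (\<Sum>s\<in>F. c s * mu_hat \<mu> (t - s)) + (\<Sum>s\<in>F. c s * cnj (c s)) = 1 - (\<Sum>s\<in>F. c s * cnj (c s))"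
    by (simp add: c' c_def[symmetric] mult.commute)
  also have "\<dots> = complex_of_real (1 - (\<Sum>s\<in>F. (cmod (mu_hat \<mu> (t - s)))\<^sup>2))"
    by (simp add: c' complex_mult_cnj cmod_power2)
  finally show ?thesis
    unfolding c_def of_real_eq_iff .
qed

lemma Bessel:
  assumes "finite F" "F \<subseteq> \<Lambda>"
  shows "(\<Sum>s\<in>F. (cmod (mu_hat \<mu> (t - s)))\<^sup>2) \<le> 1"
proof -
  have "0 \<le> (\<integral>x. (cmod (e_fun t x - (\<Sum>s\<in>F. mu_hat \<mu> (s - t) * e_fun s x)))\<^sup>2 \<partial>\<mu>)"
    by (rule Bochner_Integration.integral_nonneg) simp
  with norm_residual_squared[OF assms, of t] show ?thesis by simp
qed

lemma summable_mu_hat: "(\<lambda>s. (cmod (mu_hat \<mu> (t - s)))\<^sup>2) summable_on \<Lambda>"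
  by (rule nonneg_bdd_above_summable_on) (auto simp: bdd_above_def intro!: exI[of _ 1] Bessel)

lemma Q_fun_le_1: "Q_fun R L \<mu> t \<le> 1"
  unfolding Q_fun_def by (rule infsum_le_finite_sums[OF summable_mu_hat Bessel])

lemma Q_fun_zero: "Q_fun R L \<mu> 0 = 1"
proof (rule antisym[OF Q_fun_le_1])
  have "(\<Sum>s\<in>{0}. (cmod (mu_hat \<mu> (0 - s)))\<^sup>2) \<le> Q_fun R L \<mu> 0"
    unfolding Q_fun_def
    by (rule finite_sum_le_infsum[OF summable_mu_hat]) (auto simp: zero_in_frequencies)
  then show "1 \<le> Q_fun R L \<mu> 0" by simp
qed

text \<open>Split every frequency uniquely as \<open>l + R\<^sup>* m\<close>: the refinement equation turns the corresponding
  summand of \<open>Q t\<close> into \<open>|\<chi>\<^sub>B(t - l)|\<^sup>2\<close> times a summand of \<open>Q (\<rho>\<^sub>l t)\<close>.\<close>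

lemma ruelle_op_Q_fun: "ruelle_op R B L (Q_fun R L \<mu>) t = Q_fun R L \<mu> t"
proof -
  let ?h = "\<lambda>(l, m). l + RT *v m"
  let ?f = "\<lambda>s. (cmod (mu_hat \<mu> (t - s)))\<^sup>2"
  have "Q_fun R L \<mu> t = infsum ?f (?h ` (L \<times> \<Lambda>))"
    unfolding Q_fun_def using frequencies_eq_image by simp
  also have "\<dots> = infsum (?f \<circ> ?h) (L \<times> \<Lambda>)"
    by (rule infsum_reindex[OF inj_on_digit_expansion])
  also have "\<dots> = infsum (\<lambda>l. infsum (\<lambda>m. (?f \<circ> ?h) (l, m)) \<Lambda>) L"
  proof (rule infsum_Sigma_banach[symmetric])
    have "?f summable_on ?h ` (L \<times> \<Lambda>)"
      using summable_mu_hat frequencies_eq_image by simp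
    then show "(?f \<circ> ?h) summable_on L \<times> \<Lambda>"
      by (subst (asm) summable_on_reindex[OF inj_on_digit_expansion])
  qed
  also have "\<dots> = (\<Sum>l\<in>L. infsum (\<lambda>m. (?f \<circ> ?h) (l, m)) \<Lambda>)"
    by (rule infsum_finite[OF finite_L])
  also have "\<dots> = (\<Sum>l\<in>L. (cmod (chi_fun B (t - l)))\<^sup>2 * Q_fun R L \<mu> (rho_map R l t))"
  proof (intro sum.cong refl)
    fix l assume l: "l \<in> L"
    have "infsum (\<lambda>m. (?f \<circ> ?h) (l, m)) \<Lambda> =
        infsum (\<lambda>m. (cmod (chi_fun B (t - l)))\<^sup>2 * (cmod (mu_hat \<mu> (rho_map R l t - m)))\<^sup>2) \<Lambda>"
      using mu_hat_shift[OF l] by (intro infsum_cong) (simp add: norm_mult power_mult_distrib)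
    also have "\<dots> = (cmod (chi_fun B (t - l)))\<^sup>2 * Q_fun R L \<mu> (rho_map R l t)"
      unfolding Q_fun_def by (rule infsum_cmult_right') 
    finally show "infsum (\<lambda>m. (?f \<circ> ?h) (l, m)) \<Lambda> =
        (cmod (chi_fun B (t - l)))\<^sup>2 * Q_fun R L \<mu> (rho_map R l t)" .
  qed
  finally show ?thesis
    by (simp add: ruelle_op_def)
qed

lemma ruelle_op_defect: "ruelle_op R B L (\<lambda>t. 1 - Q_fun R L \<mu> t) = (\<lambda>t. 1 - Q_fun R L \<mu> t)"
proof
  fix t
  show "ruelle_op R B L (\<lambda>t. 1 - Q_fun R L \<mu> t) t = 1 - Q_fun R L \<mu> t"
    using ruelle_op_Q_fun[of t] sum_cmod_chi_fun_squared[of t]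
    by (simp add: ruelle_op_def right_diff_distrib sum_subtractf)
qed

lemma e_fun_in_L2: "e_fun t \<in> L2_space \<mu>"
  by (simp add: L2_space_def)

lemma H2_subspace: "L2_subspace \<mu> (H2 \<mu> \<Lambda>)"
  unfolding H2_def
  by (rule L2_subspace_closed_span) (auto simp: e_fun_in_L2 prob_space_axioms)

text \<open>\<open>Q t\<close> is the squared norm of the projection of the unit vector \<open>e\<^sub>t\<close> onto the closed span.\<close>

lemma e_fun_in_H2:
  assumes "Q_fun R L \<mu> t = 1"
  shows "e_fun t \<in> H2 \<mu> \<Lambda>"
proof -
  have "\<exists>g\<in>complex_lin_span (e_fun ` \<Lambda>). L2_norm \<mu> (\<lambda>x. e_fun t x - g x) < \<epsilon>" if \<epsilon>: "0 < \<epsilon>" for \<epsilon>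
  proof -
    have "\<not> (\<forall>F. finite F \<longrightarrow> F \<subseteq> \<Lambda> \<longrightarrow> (\<Sum>s\<in>F. (cmod (mu_hat \<mu> (t - s)))\<^sup>2) \<le> 1 - \<epsilon>\<^sup>2)"
    proof
      assume "\<forall>F. finite F \<longrightarrow> F \<subseteq> \<Lambda> \<longrightarrow> (\<Sum>s\<in>F. (cmod (mu_hat \<mu> (t - s)))\<^sup>2) \<le> 1 - \<epsilon>\<^sup>2"
      then have "Q_fun R L \<mu> t \<le> 1 - \<epsilon>\<^sup>2"
        unfolding Q_fun_def by (intro infsum_le_finite_sums[OF summable_mu_hat]) auto
      with assms \<epsilon> show False by simp
    qed
    then obtain F where F: "finite F" "F \<subseteq> \<Lambda>" "1 - \<epsilon>\<^sup>2 < (\<Sum>s\<in>F. (cmod (mu_hat \<mu> (t - s)))\<^sup>2)"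
      by (auto simp: not_le)
    let ?g = "\<lambda>x. \<Sum>s\<in>F. mu_hat \<mu> (s - t) * e_fun s x"
    have "?g \<in> complex_lin_span (e_fun ` \<Lambda>)"
      using F by (intro complex_lin_span_sum complex_lin_span_scale complex_lin_span_base) auto
    moreover have "L2_norm \<mu> (\<lambda>x. e_fun t x - ?g x) < \<epsilon>"
      using norm_residual_squared[OF F(1,2), of t] F(3) by (simp add: L2_norm_less_iff[OF \<epsilon>])
    ultimately show ?thesis by (intro bexI[where x = ?g])
  qed
  then show ?thesis
    by (simp add: H2_def L2_closed_span_def e_fun_in_L2)
qed

section \<open>The attractor of the dual system\<close>

text \<open>Take \<open>l\<close> as first digit and \<open>0\<close> for all others.\<close>

lemma neg_digit_in_X_rho:
  assumes "l \<in> L"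
  shows "- (RT_inv *v l) \<in> X_rho R L"
proof -
  let ?l = "\<lambda>k::nat. if k = 1 then l else 0"
  have "(\<lambda>k. - mat_pow_vec RT_inv (Suc k) (?l (Suc k))) = (\<lambda>k. if k = 0 then - (RT_inv *v l) else 0)"
    by auto
  then have "(\<lambda>k. - mat_pow_vec RT_inv (Suc k) (?l (Suc k))) sums - (RT_inv *v l)"
    using sums_single[of 0 "\<lambda>_. - (RT_inv *v l)"] by simp
  then show ?thesis
    unfolding X_rho_def using assms zero_in_L by (intro CollectI exI[of _ ?l]) auto
qed

lemma zero_in_Y: "0 \<in> Y_set R L"
  using hull_inc[OF neg_digit_in_X_rho[OF zero_in_L], of convex] by (simp add: Y_set_def)

lemma bounded_Y: "bounded (Y_set R L)"
proof -
  obtain a where a: "summable a" "\<And>k v. norm (mat_pow_vec RT_inv k v) \<le> a k * norm v"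
    using summable_inverse_transpose_orbit[OF expansive_R] by blast
  define K where "K = (\<Sum>l\<in>L. norm l)"
  have K: "norm l \<le> K" if "l \<in> L" for l
    unfolding K_def using that finite_L by (intro member_le_sum) auto
  \<comment> \<open>Test the bound on a unit vector.\<close>
  have a_nonneg: "0 \<le> a k" for k
    using order_trans[OF norm_ge_zero a(2)[of k "axis undefined 1"]] by (simp add: norm_axis_1)
  have "norm x \<le> (\<Sum>k. a (Suc k) * K)" if x: "x \<in> X_rho R L" for x
  proof -
    obtain l where l: "\<forall>k\<ge>1. l k \<in> L" "(\<lambda>k. - mat_pow_vec RT_inv (Suc k) (l (Suc k))) sums x"
      using x unfolding X_rho_def by blast
    have *: "norm (\<Sum>k. - mat_pow_vec RT_inv (Suc k) (l (Suc k))) \<le> (\<Sum>k. a (Suc k) * K)"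
    proof (rule norm_suminf_le)
      show "summable (\<lambda>k. a (Suc k) * K)"
        using a(1) by (intro summable_mult2) (simp add: summable_Suc_iff)
      fix k
      have "norm (- mat_pow_vec RT_inv (Suc k) (l (Suc k))) \<le> a (Suc k) * norm (l (Suc k))"
        using a(2) by (simp del: mat_pow_vec_simps)
      also have "\<dots> \<le> a (Suc k) * K"
        using l(1) by (intro mult_left_mono K a_nonneg) simp
      finally show "norm (- mat_pow_vec RT_inv (Suc k) (l (Suc k))) \<le> a (Suc k) * K" .
    qed
    show ?thesis
      unfolding sums_unique[OF l(2)] by (rule *)
  qed
  then have "bounded (X_rho R L)"
    by (auto simp: bounded_iff)
  then show ?thesis
    unfolding Y_set_def by (rule bounded_convex_hull)
qed

text \<open>Otherwise \<open>Y\<close> lies in a hyperplane, which passes through \<open>0 \<in> Y\<close> and contains all points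
  \<open>-R\<^sup>*\<^sup>-\<^sup>1 l\<close>. For its normal vector \<open>a\<close> this means that \<open>R\<^sup>-\<^sup>1 a\<close> is orthogonal to \<open>L\<close>.\<close>

lemma interior_Y_nonempty:
  assumes span: "span L = UNIV"
  shows "interior (Y_set R L) \<noteq> {}"
proof
  assume "interior (Y_set R L) = {}"
  then obtain a c where a: "a \<noteq> 0" "Y_set R L \<subseteq> {x. a \<bullet> x = c}"
    using empty_interior_subset_hyperplane[of "Y_set R L"] by (auto simp: Y_set_def)
  have "c = 0"
    using a(2) zero_in_Y by auto
  have inv: "RT_inv = transpose (matrix_inv R)"
    by (rule matrix_inv_transpose[OF expansive_invertible[OF expansive_R]])
  have orth: "orthogonal (matrix_inv R *v a) l" if "l \<in> L" for l
  proof -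
    have "- (RT_inv *v l) \<in> Y_set R L"
      unfolding Y_set_def by (rule hull_inc[OF neg_digit_in_X_rho[OF that]])
    then have "a \<bullet> - (RT_inv *v l) = c"
      using a(2) by blast
    then have "a \<bullet> (RT_inv *v l) = 0"
      using \<open>c = 0\<close> by simp
    then show ?thesis
      by (simp add: orthogonal_def inv inner_transpose_right)
  qed
  have "matrix_inv R *v a \<in> span L"
    using span by simp
  then have "orthogonal (matrix_inv R *v a) (matrix_inv R *v a)"
    by (rule orthogonal_to_span) (rule orth)
  then have "matrix_inv R *v a = 0"
    by (simp add: orthogonal_self)
  then have "R *v (matrix_inv R *v a) = 0" by simp
  then show False
    using a(1) by (simp add: matrix_vector_mul_assoc matrix_inv_mult[OF expansive_invertible[OF expansive_R]])
qed

text \<open>A real number \<open>n\<close> with \<open>n \<le> \<gamma> n\<close> and \<open>\<gamma> < 1\<close> is at most \<open>0\<close>. The gradient is bounded on the bounded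
  set \<open>Y\<close>, so its supremum there is a genuine upper bound and the gradient vanishes on \<open>Y\<close>, which is
  convex.\<close>

lemma constant_on_Y_of_contraction:
  assumes C1: "C1_function q" and \<gamma>: "\<gamma> < 1" and le: "norm_Y (Y_set R L) q \<le> \<gamma> * norm_Y (Y_set R L) q"
    and y: "y \<in> Y_set R L"
  shows "q y = q 0"
proof -
  let ?Y = "Y_set R L"
  obtain g where g: "\<And>x. GDERIV q x :> g x" "continuous_on UNIV g"
    using C1 by (auto simp: C1_function_def)
  have "D = g x" if "GDERIV q x :> D" for D x
  proof -
    have "(\<lambda>h. h \<bullet> D) = (\<lambda>h. h \<bullet> g x)"
      using that g(1)[of x] unfolding gderiv_def by (rule has_derivative_unique)
    then have "\<forall>h. h \<bullet> D = h \<bullet> g x"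
      by (simp add: fun_eq_iff)
    then show ?thesis
      by (simp only: vector_eq_ldot)
  qed
  then have grad: "grad q x = g x" for x
    unfolding grad_def using g(1) by (intro the_equality) auto
  have "compact (closure ?Y)"
    using bounded_Y by simp
  then have "bounded (g ` closure ?Y)"
    using g(2) by (intro compact_imp_bounded compact_continuous_image) (auto intro: continuous_on_subset)
  then obtain K where "norm (g x) \<le> K" if "x \<in> closure ?Y" for x
    unfolding bounded_iff by blast
  then have bdd: "bdd_above ((\<lambda>y. norm (grad q y)) ` ?Y)"
    using closure_subset[of ?Y] by (intro bdd_aboveI2[where M = K]) (auto simp: grad)
  have upper: "norm (grad q x) \<le> norm_Y ?Y q" if "x \<in> ?Y" for x
    unfolding norm_Y_def using that bdd by (rule cSUP_upper)
  have "(1 - \<gamma>) * norm_Y ?Y q \<le> 0"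
    using le by (simp add: left_diff_distrib)
  then have "norm_Y ?Y q \<le> 0"
    using \<gamma> by (simp add: mult_le_0_iff)
  with upper have zero: "g x = 0" if "x \<in> ?Y" for x
    using that by (metis grad norm_le_zero_iff order_trans)
  have "\<exists>c. \<forall>x\<in>?Y. q x = c"
  proof (rule has_derivative_zero_constant)
    show "convex ?Y" by (simp add: Y_set_def)
    fix x assume "x \<in> ?Y"
    then have "(q has_derivative (\<lambda>h. 0)) (at x)"
      using g(1)[of x] zero by (simp add: gderiv_def)
    then show "(q has_derivative (\<lambda>h. 0)) (at x within ?Y)"
      by (rule has_derivative_at_withinI)
  qed
  with y zero_in_Y show ?thesis by auto
qed

lemma H2_eq_L2_of_contraction:
  assumes span: "span L = UNIV" and C1: "C1_function (\<lambda>t. 1 - Q_fun R L \<mu> t)" and \<gamma>: "\<gamma> < 1"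
    and le: "norm_Y (Y_set R L) (ruelle_op R B L (\<lambda>t. 1 - Q_fun R L \<mu> t))
      \<le> \<gamma> * norm_Y (Y_set R L) (\<lambda>t. 1 - Q_fun R L \<mu> t)"
  shows "H2 \<mu> \<Lambda> = L2_space \<mu>"
proof -
  have Q: "Q_fun R L \<mu> y = 1" if "y \<in> Y_set R L" for y
    using constant_on_Y_of_contraction[OF C1 \<gamma> le[unfolded ruelle_op_defect] that]
    by (simp add: Q_fun_zero)
  obtain r where "AE x in \<mu>. norm x \<le> r"
    using invariant_measure_bounded_support[OF finite_B B_nonempty invariant expansive_R] by blast
  then show ?thesis
  proof (rule L2_subspace_exponentials_imp_all[OF H2_subspace sets_\<mu>])
    show "open (interior (Y_set R L))" by simp
    show "interior (Y_set R L) \<noteq> {}" by (rule interior_Y_nonempty[OF span])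
    show "e_fun t \<in> H2 \<mu> \<Lambda>" if "t \<in> interior (Y_set R L)" for t
      using that interior_subset by (intro e_fun_in_H2 Q) blast
  qed
qed

end

theorem theorem3p1:
  fixes R :: "real^'d^'d"
    and B L :: "(real^'d) set"
    and \<mu> :: "(real^'d) measure"
  assumes "expansive R"
    and "finite B" and "finite L" and "card B = card L"
    and "\<forall>n\<ge>1. \<forall>b\<in>B. \<forall>l\<in>L. mat_pow_vec R n b \<bullet> l \<in> \<int>"
    and "unitary_on B L (H_matrix B)"
    and "0 \<in> L" and "span L = UNIV"
    and "invariant_measure R B \<mu>"
    and "\<exists>\<gamma><1. \<exists>S. (\<forall>q\<in>S. C1_function q) \<and> (\<lambda>t. 1 - Q_fun R L \<mu> t) \<in> S \<and>
           (\<forall>q\<in>S. norm_Y (Y_set R L) (ruelle_op R B L q) \<le> \<gamma> * norm_Y (Y_set R L) q)"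
  shows "H2 \<mu> (frequencies R L) = L2_space \<mu>"
proof -
  interpret hadamard_system R B L \<mu>
    using assms by unfold_locales auto
  obtain \<gamma> S where "\<gamma> < 1" "\<forall>q\<in>S. C1_function q" "(\<lambda>t. 1 - Q_fun R L \<mu> t) \<in> S"
      "\<forall>q\<in>S. norm_Y (Y_set R L) (ruelle_op R B L q) \<le> \<gamma> * norm_Y (Y_set R L) q"
    using assms(10) by blast
  then show ?thesis
    by (intro H2_eq_L2_of_contraction[OF assms(8)]) auto
qed

end
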